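(* Let $(\mathsf S,\mathcal S)$ and $(\mathsf A,\mathcal A)$ be measurable spaces, let $\pi(da\mid s)$ be a Markov kernel from $(\mathsf S,\mathcal S)$ to $(\mathsf A,\mathcal A)$ (a fixed stationary policy), and let $\mathsf P(ds',dx\mid s,a)$ be a Markov kernel from $(\mathsf S\times\mathsf A,\mathcal S\otimes\mathcal A)$ to $(\mathsf S\times[0,1],\mathcal S\otimes\mathcal B([0,1]))$ (the environment). Let $(S_t,A_t)_{t\ge0}$ and rewards $(X_t)_{t\ge1}$ be generated by the fixed pair $(\pi,\mathsf P)$. Assume that under $(\pi,\mathsf P)$ the state-action process $(S_t,A_t)_{t\ge0}$ is a time-homogeneous Markov chain that is positive Harris recurrent and aperiodic, with invariant probability measure $\nu_{\pi,\mathsf P}$ on $\mathsf S\times\mathsf A$. Then $$\bar X_n:=\frac1n\sum_{t=1}^nX_t\longrightarrow\rho(\pi,\mathsf P):=\int_{\mathsf S\times\mathsf A}r(s,a)\,\nu_{\pi,\mathsf P}(ds,da)\quad\text{a.s.},$$ where $r(s,a):=\mathbb E[X_{t+1}\mid S_t=s,A_t=a]\in[0,1]$.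
   Context: "Generated by $(\pi,\mathsf P)$" means: for each $t\ge0$, given the state $S_t$ and the prior trajectory $(S_0,A_0,X_1,S_1,\ldots,X_t)$, the action $A_t$ has conditional law $\pi(\cdot\mid S_t)$; and given the history $\mathcal F_t:=\sigma(S_0,A_0,X_1,S_1,\ldots,S_t,A_t)$, the pair $(S_{t+1},X_{t+1})$ has conditional law $\mathsf P(\cdot,\cdot\mid S_t,A_t)$, with $0\le X_{t+1}\le1$. Thus $r(s,a)=\int x\,\mathsf P(ds',dx\mid s,a)$. *)

theory Defs
  imports "HOL-Probability.Probability"
begin

definition conditional_law ::
  "'w measure \<Rightarrow> 'w measure \<Rightarrow> 'b measure \<Rightarrow> ('w \<Rightarrow> 'b) \<Rightarrow> ('w \<Rightarrow> 'b measure) \<Rightarrow> bool"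
where
  "conditional_law M F N Y \<kappa> \<longleftrightarrow>
     (\<forall>B\<in>sets N. AE \<omega> in M.
        real_cond_exp M F (\<lambda>\<omega>'. indicat_real B (Y \<omega>')) \<omega> = measure (\<kappa> \<omega>) B)"


section \<open>Markov chains on general state spaces\<close>

text \<open>
  A measure \<open>N\<close> serves here only as a measurable space, and a Markov kernel from \<open>N\<close> to \<open>N'\<close> is
  an element of \<open>N \<rightarrow>\<^sub>M prob_algebra N'\<close>.
\<close>

definition markov_chain ::
  "'w measure \<Rightarrow> 'z measure \<Rightarrow> ('z \<Rightarrow> 'z measure) \<Rightarrow> (nat \<Rightarrow> 'w \<Rightarrow> 'z) \<Rightarrow> bool"
where
  "markov_chain M N K Z \<longleftrightarrow>
     K \<in> N \<rightarrow>\<^sub>M prob_algebra N \<and>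
     (\<forall>t. Z t \<in> M \<rightarrow>\<^sub>M N) \<and>
     (\<forall>t. conditional_law M
        (sigma (space M) {Z i -` B \<inter> space M |i B. i \<le> t \<and> B \<in> sets N})
        N (Z (Suc t)) (\<lambda>\<omega>. K (Z t \<omega>)))"

text \<open>
  The law on the path space \<open>\<Pi>\<^sub>M t\<in>UNIV. N\<close> of the chain with kernel \<open>K\<close> started at \<open>x\<close>,
  as provided by the Ionescu-Tulcea theorem.
\<close>

definition path_law :: "'z measure \<Rightarrow> ('z \<Rightarrow> 'z measure) \<Rightarrow> 'z \<Rightarrow> (nat \<Rightarrow> 'z) measure" where
  "path_law N K x =
     projective_family.lim UNIV
       (Ionescu_Tulcea.CI
          (\<lambda>n \<omega>. case n of 0 \<Rightarrow> return N x | Suc m \<Rightarrow> K (\<omega> m)) (\<lambda>_. N))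
       (\<lambda>_. N)"

lemma Ionescu_Tulcea_path_law:
  fixes N :: "'z measure"
  assumes K: "K \<in> N \<rightarrow>\<^sub>M prob_algebra N" and x: "x \<in> space N"
  shows "Ionescu_Tulcea (\<lambda>n \<omega>. case n of 0 \<Rightarrow> return N x | Suc m \<Rightarrow> K (\<omega> m)) (\<lambda>_. N)"
proof (rule Ionescu_Tulcea.intro)
  fix n
  have K': "K \<in> N \<rightarrow>\<^sub>M subprob_algebra N"
    using K by (rule measurable_prob_algebraD)
  show "(\<lambda>\<omega>. case n of 0 \<Rightarrow> return N x | Suc m \<Rightarrow> K (\<omega> m))
          \<in> Pi\<^sub>M {0..<n} (\<lambda>_. N) \<rightarrow>\<^sub>M subprob_algebra N"
  proof (cases n)
    case 0
    then show ?thesis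
      using x by (simp add: return_measurable measurable_space)
  next
    case (Suc m)
    have "(\<lambda>\<omega>. \<omega> m) \<in> Pi\<^sub>M {0..<n} (\<lambda>_. N) \<rightarrow>\<^sub>M N"
      using Suc by (intro measurable_component_singleton) simp
    from measurable_compose[OF this K'] show ?thesis
      using Suc by simp
  qed
next
  fix n and \<omega> :: "nat \<Rightarrow> 'z"
  assume \<omega>: "\<omega> \<in> space (Pi\<^sub>M {0..<n} (\<lambda>_. N))"
  show "prob_space (case n of 0 \<Rightarrow> return N x | Suc m \<Rightarrow> K (\<omega> m))"
  proof (cases n)
    case 0
    then show ?thesis using x by (simp add: prob_space_return)
  next
    case (Suc m)
    then have "\<omega> m \<in> space N" using \<omega> by (auto simp: space_PiM PiE_iff)
    then show ?thesis
      using measurable_space[OF K] Suc by (auto simp: space_prob_algebra)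
  qed
qed

definition irreducibility_measure :: "'z measure \<Rightarrow> ('z \<Rightarrow> 'z measure) \<Rightarrow> 'z measure \<Rightarrow> bool" where
  "irreducibility_measure N K \<phi> \<longleftrightarrow>
     sets \<phi> = sets N \<and> sigma_finite_measure \<phi> \<and> emeasure \<phi> (space N) > 0 \<and>
     (\<forall>B\<in>sets N. emeasure \<phi> B > 0 \<longrightarrow>
        (\<forall>x\<in>space N. emeasure (path_law N K x)
           {\<omega>\<in>space (path_law N K x). \<exists>t\<ge>1. \<omega> t \<in> B} > 0))"

text \<open>
  Harris condition: some nontrivial \<open>\<sigma>\<close>-finite \<open>\<phi>\<close> charges only sets that are visited
  infinitely often almost surely from every (not merely almost every) starting point.
\<close>

definition harris_recurrent :: "'z measure \<Rightarrow> ('z \<Rightarrow> 'z measure) \<Rightarrow> bool" where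
  "harris_recurrent N K \<longleftrightarrow>
     (\<exists>\<phi>. sets \<phi> = sets N \<and> sigma_finite_measure \<phi> \<and> emeasure \<phi> (space N) > 0 \<and>
       (\<forall>B\<in>sets N. emeasure \<phi> B > 0 \<longrightarrow>
          (\<forall>x\<in>space N. AE \<omega> in path_law N K x. \<exists>\<^sub>\<infinity>t. \<omega> t \<in> B)))"

definition invariant_probability :: "'z measure \<Rightarrow> ('z \<Rightarrow> 'z measure) \<Rightarrow> 'z measure \<Rightarrow> bool" where
  "invariant_probability N K \<nu> \<longleftrightarrow> \<nu> \<in> space (prob_algebra N) \<and> \<nu> \<bind> K = \<nu>"

definition positive_harris_recurrent :: "'z measure \<Rightarrow> ('z \<Rightarrow> 'z measure) \<Rightarrow> bool" where
  "positive_harris_recurrent N K \<longleftrightarrow>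
     harris_recurrent N K \<and> (\<exists>\<nu>. invariant_probability N K \<nu>)"

text \<open>
  A cyclic decomposition \<open>D 0, \<dots>, D (d - 1)\<close> is required to be full with respect to every
  irreducibility measure, equivalently with respect to a maximal one.
\<close>

definition markov_cycle ::
  "'z measure \<Rightarrow> ('z \<Rightarrow> 'z measure) \<Rightarrow> nat \<Rightarrow> (nat \<Rightarrow> 'z set) \<Rightarrow> bool"
where
  "markov_cycle N K d D \<longleftrightarrow>
     d \<ge> 1 \<and> (\<forall>i<d. D i \<in> sets N) \<and> disjoint_family_on D {..<d} \<and>
     (\<forall>i<d. \<forall>x\<in>D i. emeasure (K x) (D (Suc i mod d)) = 1) \<and>
     (\<forall>\<phi>. irreducibility_measure N K \<phi> \<longrightarrow> emeasure \<phi> (space N - (\<Union>i<d. D i)) = 0)"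

definition aperiodic :: "'z measure \<Rightarrow> ('z \<Rightarrow> 'z measure) \<Rightarrow> bool" where
  "aperiodic N K \<longleftrightarrow>
     (\<exists>\<phi>. irreducibility_measure N K \<phi>) \<and> (\<forall>d D. markov_cycle N K d D \<longrightarrow> d = 1)"


section \<open>Policy and environment\<close>

text \<open>
  The state and action spaces are \<open>\<S>\<close> and \<open>\<A>\<close>, the policy is \<open>\<pi>\<close> and the environment is \<open>P\<close>.
  Rewards \<open>X t\<close> are indexed by \<open>t \<ge> 1\<close>; \<open>X 0\<close> plays no role.
\<close>

abbreviation unit_borel :: "real measure" where
  "unit_borel \<equiv> restrict_space borel {0..1}"

definition history_before_action ::
  "'w measure \<Rightarrow> 's measure \<Rightarrow> 'a measure \<Rightarrow> (nat \<Rightarrow> 'w \<Rightarrow> 's) \<Rightarrow> (nat \<Rightarrow> 'w \<Rightarrow> 'a) \<Rightarrow>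
   (nat \<Rightarrow> 'w \<Rightarrow> real) \<Rightarrow> nat \<Rightarrow> 'w measure"
where
  "history_before_action M \<S> \<A> S A X t = sigma (space M)
     ({S i -` B \<inter> space M |i B. i \<le> t \<and> B \<in> sets \<S>} \<union>
      {A i -` B \<inter> space M |i B. i < t \<and> B \<in> sets \<A>} \<union>
      {X i -` B \<inter> space M |i B. 1 \<le> i \<and> i \<le> t \<and> B \<in> sets unit_borel})"

definition history ::
  "'w measure \<Rightarrow> 's measure \<Rightarrow> 'a measure \<Rightarrow> (nat \<Rightarrow> 'w \<Rightarrow> 's) \<Rightarrow> (nat \<Rightarrow> 'w \<Rightarrow> 'a) \<Rightarrow>
   (nat \<Rightarrow> 'w \<Rightarrow> real) \<Rightarrow> nat \<Rightarrow> 'w measure"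
where
  "history M \<S> \<A> S A X t = sigma (space M)
     ({S i -` B \<inter> space M |i B. i \<le> t \<and> B \<in> sets \<S>} \<union>
      {A i -` B \<inter> space M |i B. i \<le> t \<and> B \<in> sets \<A>} \<union>
      {X i -` B \<inter> space M |i B. 1 \<le> i \<and> i \<le> t \<and> B \<in> sets unit_borel})"

definition generated_by ::
  "'w measure \<Rightarrow> 's measure \<Rightarrow> 'a measure \<Rightarrow> ('s \<Rightarrow> 'a measure) \<Rightarrow> ('s \<times> 'a \<Rightarrow> ('s \<times> real) measure) \<Rightarrow>
   (nat \<Rightarrow> 'w \<Rightarrow> 's) \<Rightarrow> (nat \<Rightarrow> 'w \<Rightarrow> 'a) \<Rightarrow> (nat \<Rightarrow> 'w \<Rightarrow> real) \<Rightarrow> bool"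
where
  "generated_by M \<S> \<A> \<pi> P S A X \<longleftrightarrow>
     (\<forall>t. S t \<in> M \<rightarrow>\<^sub>M \<S>) \<and> (\<forall>t. A t \<in> M \<rightarrow>\<^sub>M \<A>) \<and> (\<forall>t\<ge>1. X t \<in> M \<rightarrow>\<^sub>M unit_borel) \<and>
     (\<forall>t. conditional_law M (history_before_action M \<S> \<A> S A X t) \<A>
            (A t) (\<lambda>\<omega>. \<pi> (S t \<omega>))) \<and>
     (\<forall>t. conditional_law M (history M \<S> \<A> S A X t) (\<S> \<Otimes>\<^sub>M unit_borel)
            (\<lambda>\<omega>. (S (Suc t) \<omega>, X (Suc t) \<omega>)) (\<lambda>\<omega>. P (S t \<omega>, A t \<omega>)))"

text \<open>
  Transition kernel of the state-action chain:
  first \<open>(s', x) \<sim> P (s, a)\<close>, then \<open>a' \<sim> \<pi> s'\<close>, and \<open>x\<close> is discarded.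
\<close>

definition state_action_kernel ::
  "'s measure \<Rightarrow> 'a measure \<Rightarrow> ('s \<Rightarrow> 'a measure) \<Rightarrow> ('s \<times> 'a \<Rightarrow> ('s \<times> real) measure) \<Rightarrow>
   's \<times> 'a \<Rightarrow> ('s \<times> 'a) measure"
where
  "state_action_kernel \<S> \<A> \<pi> P z =
     P z \<bind> (\<lambda>(s', x). \<pi> s' \<bind> (\<lambda>a'. return (\<S> \<Otimes>\<^sub>M \<A>) (s', a')))"

definition mean_reward :: "('s \<times> 'a \<Rightarrow> ('s \<times> real) measure) \<Rightarrow> 's \<times> 'a \<Rightarrow> real" where
  "mean_reward P z = (\<integral>y. snd y \<partial>P z)"

end

theory Submission
  imports Defs "HOL-Library.Discrete_Functions"
begin

text \<open>
  Write \<open>Z\<close> for the state-action chain, \<open>K\<close> for its kernel, \<open>r\<close> for the mean reward and \<open>\<rho>\<close> for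
  \<open>\<integral> r d\<nu>\<close>. The average reward splits as the average of \<open>X (t + 1) - r (Z t)\<close> plus the average
  of \<open>r (Z t)\<close>.
  
  The terms of the first average are bounded and orthogonal in \<open>L\<^sup>2\<close>, because \<open>r (Z t)\<close> is the
  conditional expectation of \<open>X (t + 1)\<close> given the history (\<open>reward_conditional_expectation\<close>).
  A second-moment estimate along the squares then shows that it tends to zero
  (\<open>averages_of_orthogonal\<close>).
  
  The second average converges to \<open>\<rho>\<close> by the law of large numbers for positive Harris chains
  (\<open>path_averages\<close>), proved here for bounded functions by ergodic theory on path space. Let \<open>E\<close>
  be a shift-invariant event and let \<open>h x\<close> be its probability under the chain started at \<open>x\<close>.
  Under the stationary law, \<open>h (Z n)\<close> is the conditional probability of \<open>E\<close> given the first
  \<open>n\<close> steps. As \<open>E\<close> can be approximated by events depending on finitely many steps, and as the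
  law of \<open>Z n\<close> does not depend on \<open>n\<close>, this forces \<open>\<integral> h\<^sup>2 d\<nu> = \<integral> h d\<nu>\<close>, so that \<open>h\<close> is \<open>0\<close>
  or \<open>1\<close> at \<open>\<nu>\<close>-almost every point (\<open>stationary_zero_one\<close>). The Harris condition makes one of
  the two sets \<open>h = 0\<close> and \<open>h = 1\<close> reachable almost surely from every point, and the Markov
  property carries the value of \<open>h\<close> there to the whole space: \<open>h\<close> is identically \<open>0\<close> or
  identically \<open>1\<close> (\<open>shift_invariant_trivial\<close>).
  
  This is applied to the event that the sums of \<open>f (Z t) - c\<close> are unbounded above, where \<open>c\<close>
  exceeds the mean of \<open>f\<close>. If it had probability one, the maximal ergodic lemma
  (\<open>maximal_ergodic\<close>) would make the mean of \<open>f - c\<close> nonnegative. Hence it has probability zero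
  from every starting point, and the upper limit of the averages of \<open>f\<close> is at most \<open>c\<close>.
  Replacing \<open>f\<close> by \<open>- f\<close> gives the lower limit.
\<close>

section \<open>The path law of a Markov kernel\<close>

text \<open>
  A measure \<open>N\<close> used as a measurable space, with a Markov kernel \<open>K\<close> on it. Below, \<open>\<Omega>\<close> is the
  path space and \<open>\<P> x\<close> the law on it of the chain started at \<open>x\<close>.
\<close>
locale markov_kernel =
  fixes N :: "'z measure" and K :: "'z \<Rightarrow> 'z measure"
  assumes kernel: "K \<in> N \<rightarrow>\<^sub>M prob_algebra N"
begin

abbreviation \<Omega> :: "(nat \<Rightarrow> 'z) measure" where
  "\<Omega> \<equiv> PiM UNIV (\<lambda>_. N)"

abbreviation \<P> :: "'z \<Rightarrow> (nat \<Rightarrow> 'z) measure" where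
  "\<P> \<equiv> path_law N K"

lemma kernel_subprob [measurable]: "K \<in> N \<rightarrow>\<^sub>M subprob_algebra N"
  using kernel by (rule measurable_prob_algebraD)

lemma prob_space_kernel: "x \<in> space N \<Longrightarrow> prob_space (K x)"
  using measurable_space[OF kernel] by (auto simp: space_prob_algebra)

lemma sets_kernel_eq [simp]: "x \<in> space N \<Longrightarrow> sets (K x) = sets N"
  using measurable_space[OF kernel] by (auto simp: space_prob_algebra)

lemma space_kernel_eq [simp]: "x \<in> space N \<Longrightarrow> space (K x) = space N"
  by (rule sets_eq_imp_space_eq) simp

lemma borel_measurable_kernel_integral [measurable (raw)]:
  assumes "f \<in> borel_measurable N"
  shows "(\<lambda>x. \<integral>\<^sup>+y. f y \<partial>K x) \<in> borel_measurable N"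
  using assms by measurable

text \<open>
  The finite-dimensional distribution operator: \<open>fdd n g x\<close> is the expectation of
  \<open>g 0 (Z 0) * \<dots> * g n (Z n)\<close> for the chain \<open>Z\<close> with kernel \<open>K\<close> started at \<open>x\<close>. The recursion
  peels off the first coordinate.
\<close>
primrec fdd :: "nat \<Rightarrow> (nat \<Rightarrow> 'z \<Rightarrow> ennreal) \<Rightarrow> 'z \<Rightarrow> ennreal" where
  "fdd 0 g x = g 0 x"
| "fdd (Suc n) g x = g 0 x * (\<integral>\<^sup>+y. fdd n (\<lambda>i. g (Suc i)) y \<partial>K x)"

lemma borel_measurable_fdd:
  assumes "\<And>i. g i \<in> borel_measurable N"
  shows "fdd n g \<in> borel_measurable N"
  using assms
proof (induction n arbitrary: g)
  case 0
  then show ?case by (simp add: fun_eq_iff cong: measurable_cong)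
next
  case (Suc n)
  have [measurable]: "fdd n (\<lambda>i. g (Suc i)) \<in> borel_measurable N" "g 0 \<in> borel_measurable N"
    using Suc by auto
  show ?case by simp
qed

text \<open>
  The operator may equally be peeled from the last coordinate. One-step conditioning produces
  the latter form; the recursion of \<open>fdd\<close> matches the former.
\<close>
lemma fdd_Suc_last:
  assumes "x \<in> space N"
  shows "fdd (Suc n) g x = fdd n (g(n := \<lambda>y. g n y * (\<integral>\<^sup>+z. g (Suc n) z \<partial>K y))) x"
  using assms
proof (induction n arbitrary: g x)
  case 0
  then show ?case by simp
next
  case (Suc n)
  let ?g = "\<lambda>i. g (Suc i)"
  have eq: "(\<lambda>i. (g(Suc n := \<lambda>y. g (Suc n) y * (\<integral>\<^sup>+z. g (Suc (Suc n)) z \<partial>K y))) (Suc i)) =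
        ?g(n := \<lambda>y. ?g n y * (\<integral>\<^sup>+z. ?g (Suc n) z \<partial>K y))"
    by auto
  have "fdd (Suc (Suc n)) g x = g 0 x * (\<integral>\<^sup>+y. fdd (Suc n) ?g y \<partial>K x)"
    by simp
  also have "(\<integral>\<^sup>+y. fdd (Suc n) ?g y \<partial>K x) =
      (\<integral>\<^sup>+y. fdd n (?g(n := \<lambda>y. ?g n y * (\<integral>\<^sup>+z. ?g (Suc n) z \<partial>K y))) y \<partial>K x)"
    using Suc.prems by (intro nn_integral_cong Suc.IH) simp
  finally show ?case
    unfolding eq[symmetric] by simp
qed

text \<open>
  Any process that satisfies the one-step Markov identity has the finite-dimensional
  distributions of the kernel. This applies both to the coordinate process of the
  Ionescu-Tulcea construction and to a chain on an arbitrary probability space.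
\<close>
lemma nn_integral_fdd:
  assumes Z: "\<And>i. Z i \<in> \<mu> \<rightarrow>\<^sub>M N"
    and step: "\<And>n g h. (\<And>i. g i \<in> borel_measurable N) \<Longrightarrow> h \<in> borel_measurable N \<Longrightarrow>
      (\<integral>\<^sup>+\<omega>. (\<Prod>i\<le>n. g i (Z i \<omega>)) * h (Z (Suc n) \<omega>) \<partial>\<mu>) =
      (\<integral>\<^sup>+\<omega>. (\<Prod>i\<le>n. g i (Z i \<omega>)) * (\<integral>\<^sup>+z. h z \<partial>K (Z n \<omega>)) \<partial>\<mu>)"
    and g: "\<And>i. g i \<in> borel_measurable N"
  shows "(\<integral>\<^sup>+\<omega>. (\<Prod>i\<le>n. g i (Z i \<omega>)) \<partial>\<mu>) = (\<integral>\<^sup>+\<omega>. fdd n g (Z 0 \<omega>) \<partial>\<mu>)"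
  using g
proof (induction n arbitrary: g)
  case 0
  then show ?case by simp
next
  case (Suc n)
  note [measurable] = Suc.prems
  let ?g = "g(n := \<lambda>y. g n y * (\<integral>\<^sup>+z. g (Suc n) z \<partial>K y))"
  have g': "?g i \<in> borel_measurable N" for i
    by auto
  have "(\<integral>\<^sup>+\<omega>. (\<Prod>i\<le>Suc n. g i (Z i \<omega>)) \<partial>\<mu>) =
      (\<integral>\<^sup>+\<omega>. (\<Prod>i\<le>n. g i (Z i \<omega>)) * g (Suc n) (Z (Suc n) \<omega>) \<partial>\<mu>)"
    by simp
  also have "\<dots> = (\<integral>\<^sup>+\<omega>. (\<Prod>i\<le>n. g i (Z i \<omega>)) * (\<integral>\<^sup>+z. g (Suc n) z \<partial>K (Z n \<omega>)) \<partial>\<mu>)"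
    by (intro step) auto
  also have "\<dots> = (\<integral>\<^sup>+\<omega>. (\<Prod>i\<le>n. ?g i (Z i \<omega>)) \<partial>\<mu>)"
  proof (intro nn_integral_cong)
    fix \<omega>
    have "(\<Prod>i\<le>n. ?g i (Z i \<omega>)) = (\<Prod>i<n. g i (Z i \<omega>)) * ?g n (Z n \<omega>)"
      by (simp add: lessThan_Suc_atMost[symmetric] prod.lessThan_Suc)
    then show "(\<Prod>i\<le>n. g i (Z i \<omega>)) * (\<integral>\<^sup>+z. g (Suc n) z \<partial>K (Z n \<omega>)) = (\<Prod>i\<le>n. ?g i (Z i \<omega>))"
      by (simp add: lessThan_Suc_atMost[symmetric] prod.lessThan_Suc mult.assoc)
  qed
  also have "\<dots> = (\<integral>\<^sup>+\<omega>. fdd n ?g (Z 0 \<omega>) \<partial>\<mu>)"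
    by (rule Suc.IH) (rule g')
  also have "\<dots> = (\<integral>\<^sup>+\<omega>. fdd (Suc n) g (Z 0 \<omega>) \<partial>\<mu>)"
    using measurable_space[OF Z[of 0]] by (intro nn_integral_cong fdd_Suc_last[symmetric])
  finally show ?case .
qed

text \<open>
  The paths whose coordinates \<open>0, \<dots>, n\<close> lie in the prescribed sets; \<open>B i\<close> is ignored for \<open>i > n\<close>.
\<close>
definition cylinder :: "nat \<Rightarrow> (nat \<Rightarrow> 'z set) \<Rightarrow> (nat \<Rightarrow> 'z) set" where
  "cylinder n B = {\<omega>\<in>space \<Omega>. \<forall>i\<le>n. \<omega> i \<in> B i}"

text \<open>
  The \<open>\<pi>\<close>-system of measurable cylinders, which generates \<open>\<Omega>\<close>.
\<close>
definition cylinders :: "(nat \<Rightarrow> 'z) set set" where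
  "cylinders = {cylinder n B | n B. \<forall>i. B i \<in> sets N}"

lemma forall_le_Suc: "(\<forall>i\<le>Suc n. Q i) \<longleftrightarrow> Q 0 \<and> (\<forall>i\<le>n. Q (Suc i))"
  by (metis Suc_le_mono le0 not0_implies_Suc)

lemma indicator_cylinder:
  "\<omega> \<in> space \<Omega> \<Longrightarrow> indicator (cylinder n B) \<omega> = (\<Prod>i\<le>n. indicator (B i) (\<omega> i) :: ennreal)"
  by (auto simp: cylinder_def indicator_def prod_zero_iff)

lemma sets_cylinder [measurable]:
  assumes [measurable]: "\<And>i. B i \<in> sets N"
  shows "cylinder n B \<in> sets \<Omega>"
  unfolding cylinder_def by measurable

lemma cylinder_extend:
  assumes "\<And>i. B i \<in> sets N" "n \<le> m"
  shows "cylinder n B = cylinder m (\<lambda>i. if i \<le> n then B i else space N)"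
  using assms(2) by (auto simp: cylinder_def space_PiM)

lemma Int_stable_cylinders: "Int_stable cylinders"
proof (rule Int_stableI)
  fix a b assume "a \<in> cylinders" "b \<in> cylinders"
  then obtain n A m B where a: "a = cylinder n A" "\<And>i. A i \<in> sets N"
    and b: "b = cylinder m B" "\<And>i. B i \<in> sets N"
    unfolding cylinders_def by blast
  let ?n = "max n m"
  have "a \<inter> b = cylinder ?n (\<lambda>i. (if i \<le> n then A i else space N) \<inter> (if i \<le> m then B i else space N))"
    using cylinder_extend[of A n ?n] cylinder_extend[of B m ?n] a b
    by (auto simp: cylinder_def)
  moreover have "\<forall>i. (if i \<le> n then A i else space N) \<inter> (if i \<le> m then B i else space N) \<in> sets N"
    using a b by auto
  ultimately show "a \<inter> b \<in> cylinders"
    unfolding cylinders_def by blast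
qed

lemma cylinders_subset: "cylinders \<subseteq> Pow (space \<Omega>)"
  by (auto simp: cylinders_def cylinder_def)

lemma space_in_cylinders: "space \<Omega> \<in> cylinders"
proof -
  have "space \<Omega> = cylinder 0 (\<lambda>_. space N)"
    by (auto simp: cylinder_def space_PiM)
  then show ?thesis
    unfolding cylinders_def by blast
qed

lemma sets_\<Omega>: "sets \<Omega> = sigma_sets (space \<Omega>) cylinders"
proof
  show "sigma_sets (space \<Omega>) cylinders \<subseteq> sets \<Omega>"
    by (rule sets.sigma_sets_subset) (auto simp: cylinders_def)
  have "{{f \<in> space \<Omega>. f i \<in> A} |i A. i \<in> UNIV \<and> A \<in> sets N} \<subseteq> cylinders"
  proof safe
    fix i A assume "A \<in> sets N"
    moreover have "{f \<in> space \<Omega>. f i \<in> A} = cylinder i (\<lambda>j. if j = i then A else space N)"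
      by (auto simp: cylinder_def space_PiM)
    ultimately show "{f \<in> space \<Omega>. f i \<in> A} \<in> cylinders"
      unfolding cylinders_def by fastforce
  qed
  then show "sets \<Omega> \<subseteq> sigma_sets (space \<Omega>) cylinders"
    unfolding sets_PiM_single space_PiM by (rule sigma_sets_subseteq)
qed

lemma path_measure_eqI:
  assumes "sets \<mu> = sets \<Omega>" "sets \<mu>' = sets \<Omega>" "emeasure \<mu> (space \<Omega>) \<noteq> \<infinity>"
    and eq: "\<And>n B. (\<And>i. B i \<in> sets N) \<Longrightarrow> emeasure \<mu> (cylinder n B) = emeasure \<mu>' (cylinder n B)"
  shows "\<mu> = \<mu>'"
proof (rule measure_eqI_generator_eq[OF Int_stable_cylinders cylinders_subset,
      where A="\<lambda>_. space \<Omega>"])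
  show "emeasure \<mu> X = emeasure \<mu>' X" if "X \<in> cylinders" for X
    using that eq unfolding cylinders_def by blast
qed (use assms space_in_cylinders sets_\<Omega> in auto)

context
  fixes x assumes x: "x \<in> space N"
begin

interpretation IT: Ionescu_Tulcea "\<lambda>n \<omega>. case n of 0 \<Rightarrow> return N x | Suc m \<Rightarrow> K (\<omega> m)" "\<lambda>_. N"
  by (rule Ionescu_Tulcea_path_law[OF kernel x])

lemma path_law_eq_lim: "\<P> x = IT.PF.lim"
  by (simp add: path_law_def)

lemma sets_path_law [simp]: "sets (\<P> x) = sets \<Omega>"
  unfolding path_law_eq_lim by simp

lemma space_path_law [simp]: "space (\<P> x) = space \<Omega>"
  by (rule sets_eq_imp_space_eq) simp

text \<open>
  The law of the first \<open>n\<close> coordinates is the \<open>n\<close>-step Ionescu-Tulcea kernel \<open>C 0 n\<close>.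
\<close>
lemma distr_path_law_restrict:
  "distr (\<P> x) (PiM {0..<n} (\<lambda>_. N)) (\<lambda>\<omega>. restrict \<omega> {0..<n}) = IT.C 0 n (\<lambda>_. undefined)"
proof (rule measure_eqI)
  have u: "(\<lambda>_. undefined) \<in> space (PiM {0..<0::nat} (\<lambda>_. N))"
    by (simp add: space_PiM)
  show "sets (distr (\<P> x) (PiM {0..<n} (\<lambda>_. N)) (\<lambda>\<omega>. restrict \<omega> {0..<n})) =
      sets (IT.C 0 n (\<lambda>_. undefined))"
    using IT.sets_C[OF u] by simp
  fix A assume "A \<in> sets (distr (\<P> x) (PiM {0..<n} (\<lambda>_. N)) (\<lambda>\<omega>. restrict \<omega> {0..<n}))"
  then have A: "A \<in> sets (PiM {0..<n} (\<lambda>_. N))" by simp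
  have "emeasure (distr (\<P> x) (PiM {0..<n} (\<lambda>_. N)) (\<lambda>\<omega>. restrict \<omega> {0..<n})) A =
      emeasure (IT.CI {0..<n}) A"
    unfolding path_law_eq_lim by (simp add: IT.distr_lim)
  also have "\<dots> = emeasure (IT.C 0 n (\<lambda>_. undefined)) A"
    using A sets.sets_into_space[OF A]
    by (subst IT.emeasure_CI[of _ n]) (auto simp: prod_emb_id space_PiM)
  finally show "emeasure (distr (\<P> x) (PiM {0..<n} (\<lambda>_. N)) (\<lambda>\<omega>. restrict \<omega> {0..<n})) A =
      emeasure (IT.C 0 n (\<lambda>_. undefined)) A" .
qed

lemma prob_space_path_law: "prob_space (\<P> x)"
proof (rule prob_space_distrD)
  show "(\<lambda>\<omega>. restrict \<omega> {0..<0}) \<in> \<P> x \<rightarrow>\<^sub>M PiM {0..<0} (\<lambda>_. N)"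
    by (subst measurable_cong_sets[OF sets_path_law refl]) (rule measurable_restrict_subset, simp)
  show "prob_space (distr (\<P> x) (PiM {0..<0} (\<lambda>_. N)) (\<lambda>\<omega>. restrict \<omega> {0..<0}))"
    unfolding distr_path_law_restrict by (rule IT.prob_space_C) (simp add: space_PiM)
qed

lemma nn_integral_path_law_restrict:
  assumes f: "f \<in> borel_measurable (PiM {0..<n} (\<lambda>_. N))"
  shows "(\<integral>\<^sup>+\<omega>. f (restrict \<omega> {0..<n}) \<partial>\<P> x) = (\<integral>\<^sup>+\<omega>. f \<omega> \<partial>IT.C 0 n (\<lambda>_. undefined))"
proof -
  have "(\<lambda>\<omega>. restrict \<omega> {0..<n}) \<in> \<P> x \<rightarrow>\<^sub>M PiM {0..<n} (\<lambda>_. N)"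
    by (subst measurable_cong_sets[OF sets_path_law refl]) (rule measurable_restrict_subset, simp)
  then show ?thesis
    unfolding distr_path_law_restrict[symmetric] using f by (simp add: nn_integral_distr)
qed

lemma path_law_start:
  assumes [measurable]: "f \<in> borel_measurable N"
  shows "(\<integral>\<^sup>+\<omega>. f (\<omega> 0) \<partial>\<P> x) = f x"
proof -
  have u: "(\<lambda>_. undefined) \<in> space (PiM {} (\<lambda>_. N))"
    by (simp add: space_PiM)
  have [measurable]: "(\<lambda>\<omega>. f (\<omega> 0)) \<in> borel_measurable (PiM {0..<Suc 0} (\<lambda>_. N))"
    by measurable
  have "(\<integral>\<^sup>+\<omega>. f (\<omega> 0) \<partial>\<P> x) = (\<integral>\<^sup>+\<omega>. f (\<omega> 0) \<partial>IT.C 0 (Suc 0) (\<lambda>_. undefined))"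
    by (subst nn_integral_path_law_restrict[symmetric]) auto
  also have "\<dots> = (\<integral>\<^sup>+\<omega>. f (\<omega> 0) \<partial>IT.eP 0 (\<lambda>_. undefined))"
    using IT.measurable_eP[of 0] u by (simp add: bind_return[where N="PiM {0..<Suc 0} (\<lambda>_. N)"])
  also have "\<dots> = f x"
    using u x by (subst IT.nn_integral_eP) (auto simp: nn_integral_return)
  finally show ?thesis .
qed

lemma path_law_step:
  assumes [measurable]: "\<And>i. g i \<in> borel_measurable N" "h \<in> borel_measurable N"
  shows "(\<integral>\<^sup>+\<omega>. (\<Prod>i\<le>n. g i (\<omega> i)) * h (\<omega> (Suc n)) \<partial>\<P> x) =
         (\<integral>\<^sup>+\<omega>. (\<Prod>i\<le>n. g i (\<omega> i)) * (\<integral>\<^sup>+z. h z \<partial>K (\<omega> n)) \<partial>\<P> x)"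
proof -
  let ?u = "\<lambda>_::nat. undefined::'z"
  let ?M = "\<lambda>n. PiM {0..<n} (\<lambda>_::nat. N)"
  have u: "?u \<in> space (?M 0)"
    by (simp add: space_PiM)
  have [measurable]: "(\<lambda>\<omega>. \<omega> i) \<in> ?M m \<rightarrow>\<^sub>M N" if "i < m" for i m
    using that by (intro measurable_component_singleton) simp
  have prod_meas: "(\<lambda>\<omega>. \<Prod>i\<le>n. g i (\<omega> i)) \<in> borel_measurable (?M m)" if "n < m" for m
    using that by (intro borel_measurable_prod_ennreal) auto
  have m1 [measurable]: "(\<lambda>\<omega>. (\<Prod>i\<le>n. g i (\<omega> i)) * h (\<omega> (Suc n))) \<in> borel_measurable (?M (Suc (Suc n)))"
    using prod_meas[of "Suc (Suc n)"] by measurable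
  have m2 [measurable]: "(\<lambda>\<omega>. (\<Prod>i\<le>n. g i (\<omega> i)) * (\<integral>\<^sup>+z. h z \<partial>K (\<omega> n))) \<in> borel_measurable (?M (Suc n))"
    using prod_meas[of "Suc n"] by measurable
  have "(\<integral>\<^sup>+\<omega>. (\<Prod>i\<le>n. g i (\<omega> i)) * h (\<omega> (Suc n)) \<partial>\<P> x) =
      (\<integral>\<^sup>+\<omega>. (\<Prod>i\<le>n. g i (\<omega> i)) * h (\<omega> (Suc n)) \<partial>IT.C 0 (Suc (Suc n)) ?u)"
    by (subst nn_integral_path_law_restrict[OF m1, symmetric]) (auto intro!: nn_integral_cong prod.cong)
  also have "\<dots> = (\<integral>\<^sup>+\<omega>. \<integral>\<^sup>+\<omega>'. (\<Prod>i\<le>n. g i (\<omega>' i)) * h (\<omega>' (Suc n)) \<partial>IT.eP (Suc n) \<omega> \<partial>IT.C 0 (Suc n) ?u)"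
    unfolding IT.C.simps(2)[of 0 "Suc n"] add_0
    using IT.sets_C[OF u, of "Suc n"] IT.measurable_eP[of "Suc n"]
    by (intro nn_integral_bind[OF m1]) (simp cong: measurable_cong_sets)
  also have "\<dots> = (\<integral>\<^sup>+\<omega>. (\<Prod>i\<le>n. g i (\<omega> i)) * (\<integral>\<^sup>+z. h z \<partial>K (\<omega> n)) \<partial>IT.C 0 (Suc n) ?u)"
  proof (intro nn_integral_cong)
    fix \<omega> assume "\<omega> \<in> space (IT.C 0 (Suc n) ?u)"
    then have \<omega>: "\<omega> \<in> space (?M (Suc n))"
      using IT.space_C[OF u, of "Suc n"] by simp
    then have \<omega>n: "\<omega> n \<in> space N"
      by (auto simp: space_PiM)
    have "(\<integral>\<^sup>+\<omega>'. (\<Prod>i\<le>n. g i (\<omega>' i)) * h (\<omega>' (Suc n)) \<partial>IT.eP (Suc n) \<omega>) =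
        (\<integral>\<^sup>+z. (\<Prod>i\<le>n. g i (\<omega> i)) * h z \<partial>K (\<omega> n))"
      using \<omega> by (subst IT.nn_integral_eP) auto
    also have "\<dots> = (\<Prod>i\<le>n. g i (\<omega> i)) * (\<integral>\<^sup>+z. h z \<partial>K (\<omega> n))"
      using \<omega>n by (intro nn_integral_cmult) (simp cong: measurable_cong_sets)
    finally show "(\<integral>\<^sup>+\<omega>'. (\<Prod>i\<le>n. g i (\<omega>' i)) * h (\<omega>' (Suc n)) \<partial>IT.eP (Suc n) \<omega>) =
        (\<Prod>i\<le>n. g i (\<omega> i)) * (\<integral>\<^sup>+z. h z \<partial>K (\<omega> n))" .
  qed
  also have "\<dots> = (\<integral>\<^sup>+\<omega>. (\<Prod>i\<le>n. g i (\<omega> i)) * (\<integral>\<^sup>+z. h z \<partial>K (\<omega> n)) \<partial>\<P> x)"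
    by (subst nn_integral_path_law_restrict[OF m2, symmetric]) (auto intro!: nn_integral_cong prod.cong)
  finally show ?thesis .
qed

lemma measurable_component_path_law: "(\<lambda>\<omega>. \<omega> i) \<in> \<P> x \<rightarrow>\<^sub>M N"
  by (subst measurable_cong_sets[OF sets_path_law refl]) (rule measurable_component_singleton, simp)

lemma nn_integral_path_law_prod:
  assumes g: "\<And>i. g i \<in> borel_measurable N"
  shows "(\<integral>\<^sup>+\<omega>. (\<Prod>i\<le>n. g i (\<omega> i)) \<partial>\<P> x) = fdd n g x"
  using nn_integral_fdd[where Z="\<lambda>i \<omega>. \<omega> i" and n=n, OF measurable_component_path_law path_law_step g]
  unfolding path_law_start[OF borel_measurable_fdd[OF g]] .

lemma emeasure_path_law_cylinder:
  assumes "\<And>i. B i \<in> sets N"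
  shows "emeasure (\<P> x) (cylinder n B) = fdd n (\<lambda>i. indicator (B i)) x"
proof -
  have "emeasure (\<P> x) (cylinder n B) = (\<integral>\<^sup>+\<omega>. indicator (cylinder n B) \<omega> \<partial>\<P> x)"
    using assms by simp
  also have "\<dots> = (\<integral>\<^sup>+\<omega>. (\<Prod>i\<le>n. indicator (B i) (\<omega> i)) \<partial>\<P> x)"
    by (intro nn_integral_cong indicator_cylinder) simp
  also have "\<dots> = fdd n (\<lambda>i. indicator (B i)) x"
    using assms by (intro nn_integral_path_law_prod) simp
  finally show ?thesis .
qed

end

lemma measurable_path_law: "\<P> \<in> N \<rightarrow>\<^sub>M prob_algebra \<Omega>"
proof (rule measurable_prob_algebra_generated[OF sets_\<Omega> Int_stable_cylinders cylinders_subset])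
  fix A assume "A \<in> cylinders"
  then obtain n B where A: "A = cylinder n B" "\<And>i. B i \<in> sets N"
    unfolding cylinders_def by blast
  have "fdd n (\<lambda>i. indicator (B i)) \<in> borel_measurable N"
    using A by (intro borel_measurable_fdd) simp
  then show "(\<lambda>a. emeasure (\<P> a) A) \<in> borel_measurable N"
    using A by (simp add: emeasure_path_law_cylinder cong: measurable_cong)
qed (auto simp: prob_space_path_law)

lemma measurable_path_law_subprob [measurable]: "\<P> \<in> N \<rightarrow>\<^sub>M subprob_algebra \<Omega>"
  using measurable_path_law by (rule measurable_prob_algebraD)

lemma measurable_case_nat_path [measurable]:
  assumes "x \<in> space N"
  shows "case_nat x \<in> \<Omega> \<rightarrow>\<^sub>M \<Omega>"
proof (rule measurable_PiM_single')
  show "(\<lambda>\<omega>. case i of 0 \<Rightarrow> x | Suc j \<Rightarrow> \<omega> j) \<in> \<Omega> \<rightarrow>\<^sub>M N" for i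
    using assms by (cases i) auto
  show "(\<lambda>\<omega> i. case i of 0 \<Rightarrow> x | Suc j \<Rightarrow> \<omega> j) \<in> space \<Omega> \<rightarrow> UNIV \<rightarrow>\<^sub>E space N"
    using assms by (auto simp: space_PiM PiE_iff split: nat.split)
qed

text \<open>
  Running the chain from \<open>x\<close> means making one step to \<open>y\<close> and then running it from \<open>y\<close>. All
  later properties of \<open>\<P>\<close> follow from this recursion, its measurability and its values on
  cylinders.
\<close>
lemma path_law_unfold:
  assumes x: "x \<in> space N"
  shows "\<P> x = K x \<bind> (\<lambda>y. distr (\<P> y) \<Omega> (case_nat x))"
proof -
  interpret Kx: prob_space "K x" by (rule prob_space_kernel[OF x])
  have ne: "space (K x) \<noteq> {}" by (rule Kx.not_empty)
  have m0: "(\<lambda>y. distr (\<P> y) \<Omega> (case_nat x)) \<in> N \<rightarrow>\<^sub>M subprob_algebra \<Omega>"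
    by (rule measurable_compose[OF measurable_path_law_subprob measurable_distr[OF measurable_case_nat_path[OF x]]])
  then have m: "(\<lambda>y. distr (\<P> y) \<Omega> (case_nat x)) \<in> K x \<rightarrow>\<^sub>M subprob_algebra \<Omega>"
    using x by (simp cong: measurable_cong_sets)
  show ?thesis
  proof (rule path_measure_eqI)
    show "sets (K x \<bind> (\<lambda>y. distr (\<P> y) \<Omega> (case_nat x))) = sets \<Omega>"
      using ne by (intro sets_bind) auto
    show "emeasure (\<P> x) (space \<Omega>) \<noteq> \<infinity>"
      using prob_space.emeasure_space_1[OF prob_space_path_law[OF x]] x by simp
    fix n and B :: "nat \<Rightarrow> 'z set" assume B: "\<And>i. B i \<in> sets N"
    have "emeasure (K x \<bind> (\<lambda>y. distr (\<P> y) \<Omega> (case_nat x))) (cylinder n B) =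
        (\<integral>\<^sup>+y. emeasure (distr (\<P> y) \<Omega> (case_nat x)) (cylinder n B) \<partial>K x)"
      using B by (intro emeasure_bind[OF ne m]) simp
    also have "\<dots> = (\<integral>\<^sup>+y. emeasure (\<P> y) (case_nat x -` cylinder n B \<inter> space \<Omega>) \<partial>K x)"
    proof (intro nn_integral_cong)
      fix y assume "y \<in> space (K x)"
      then have y: "y \<in> space N" using x by simp
      have "case_nat x \<in> \<P> y \<rightarrow>\<^sub>M \<Omega>"
        using measurable_case_nat_path[OF x] y by (simp cong: measurable_cong_sets)
      then show "emeasure (distr (\<P> y) \<Omega> (case_nat x)) (cylinder n B) =
          emeasure (\<P> y) (case_nat x -` cylinder n B \<inter> space \<Omega>)"
        using B y by (simp add: emeasure_distr)
    qed
    also have "\<dots> = fdd n (\<lambda>i. indicator (B i)) x"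
    proof (cases n)
      case 0
      have "case_nat x -` cylinder n B \<inter> space \<Omega> = (if x \<in> B 0 then space \<Omega> else {})"
        using measurable_space[OF measurable_case_nat_path[OF x]] unfolding 0 cylinder_def by auto
      then have "(\<integral>\<^sup>+y. emeasure (\<P> y) (case_nat x -` cylinder n B \<inter> space \<Omega>) \<partial>K x) =
          (\<integral>\<^sup>+y. indicator (B 0) x \<partial>K x)"
        using x prob_space_path_law[THEN prob_space.emeasure_space_1]
        by (intro nn_integral_cong) auto
      then show ?thesis
        using 0 by (simp add: Kx.emeasure_space_1)
    next
      case (Suc m)
      have "case_nat x -` cylinder n B \<inter> space \<Omega> =
          (if x \<in> B 0 then cylinder m (\<lambda>i. B (Suc i)) else {})"
        using measurable_space[OF measurable_case_nat_path[OF x]]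
        unfolding Suc cylinder_def forall_le_Suc by auto
      then have "(\<integral>\<^sup>+y. emeasure (\<P> y) (case_nat x -` cylinder n B \<inter> space \<Omega>) \<partial>K x) =
          (\<integral>\<^sup>+y. indicator (B 0) x * fdd m (\<lambda>i. indicator (B (Suc i))) y \<partial>K x)"
        using x B by (intro nn_integral_cong) (auto simp: emeasure_path_law_cylinder)
      also have "\<dots> = indicator (B 0) x * (\<integral>\<^sup>+y. fdd m (\<lambda>i. indicator (B (Suc i))) y \<partial>K x)"
        using x B by (intro nn_integral_cmult) (simp add: borel_measurable_fdd cong: measurable_cong_sets)
      finally show ?thesis
        using Suc by simp
    qed
    finally show "emeasure (\<P> x) (cylinder n B) =
        emeasure (K x \<bind> (\<lambda>y. distr (\<P> y) \<Omega> (case_nat x))) (cylinder n B)"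
      using x B by (simp add: emeasure_path_law_cylinder)
  qed (use x in simp)
qed

end

section \<open>The Markov property and shift-invariant events\<close>

context markov_kernel
begin

lemma measurable_component: "(\<lambda>\<omega>. \<omega> n) \<in> \<Omega> \<rightarrow>\<^sub>M N"
  by (rule measurable_component_singleton) simp

lemma measurable_path_lawI: "x \<in> space N \<Longrightarrow> f \<in> \<Omega> \<rightarrow>\<^sub>M L \<Longrightarrow> f \<in> \<P> x \<rightarrow>\<^sub>M L"
  by (subst measurable_cong_sets[OF sets_path_law refl])

lemma measurable_kernelI: "x \<in> space N \<Longrightarrow> f \<in> N \<rightarrow>\<^sub>M L \<Longrightarrow> f \<in> K x \<rightarrow>\<^sub>M L"
  by (subst measurable_cong_sets[OF sets_kernel_eq refl])

lemma nn_integral_path_law_indicator: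
  "x \<in> space N \<Longrightarrow> E \<in> sets \<Omega> \<Longrightarrow> (\<integral>\<^sup>+\<omega>. indicator E \<omega> \<partial>\<P> x) = emeasure (\<P> x) E"
  by simp

lemma measurable_shift: "(\<lambda>\<omega> i. \<omega> (n + i)) \<in> \<Omega> \<rightarrow>\<^sub>M \<Omega>"
  by (rule measurable_PiM_single') (auto simp: space_PiM PiE_iff)

lemma measurable_shift_Suc: "(\<lambda>\<omega> i. \<omega> (Suc i)) \<in> \<Omega> \<rightarrow>\<^sub>M \<Omega>"
  using measurable_shift[of 1] by simp

lemma nn_integral_path_law_measurable:
  assumes "f \<in> borel_measurable \<Omega>"
  shows "(\<lambda>x. \<integral>\<^sup>+\<omega>. f \<omega> \<partial>\<P> x) \<in> borel_measurable N"
  using assms by measurable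

lemma nn_integral_path_law_unfold:
  assumes x: "x \<in> space N" and f: "f \<in> borel_measurable \<Omega>"
  shows "(\<integral>\<^sup>+\<omega>. f \<omega> \<partial>\<P> x) = (\<integral>\<^sup>+y. \<integral>\<^sup>+\<omega>. f (case_nat x \<omega>) \<partial>\<P> y \<partial>K x)"
proof -
  have "(\<lambda>y. distr (\<P> y) \<Omega> (case_nat x)) \<in> N \<rightarrow>\<^sub>M subprob_algebra \<Omega>"
    by (rule measurable_compose[OF measurable_path_law_subprob measurable_distr[OF measurable_case_nat_path[OF x]]])
  then have m: "(\<lambda>y. distr (\<P> y) \<Omega> (case_nat x)) \<in> K x \<rightarrow>\<^sub>M subprob_algebra \<Omega>"
    by (rule measurable_kernelI[OF x])
  have "(\<integral>\<^sup>+\<omega>. f \<omega> \<partial>\<P> x) = (\<integral>\<^sup>+y. \<integral>\<^sup>+\<omega>. f \<omega> \<partial>distr (\<P> y) \<Omega> (case_nat x) \<partial>K x)"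
    by (subst path_law_unfold[OF x]) (rule nn_integral_bind[OF f m])
  also have "\<dots> = (\<integral>\<^sup>+y. \<integral>\<^sup>+\<omega>. f (case_nat x \<omega>) \<partial>\<P> y \<partial>K x)"
  proof (intro nn_integral_cong)
    fix y assume "y \<in> space (K x)"
    then have "case_nat x \<in> \<P> y \<rightarrow>\<^sub>M \<Omega>"
      using x by (intro measurable_path_lawI measurable_case_nat_path) auto
    then show "(\<integral>\<^sup>+\<omega>. f \<omega> \<partial>distr (\<P> y) \<Omega> (case_nat x)) = (\<integral>\<^sup>+\<omega>. f (case_nat x \<omega>) \<partial>\<P> y)"
      using f by (simp add: nn_integral_distr)
  qed
  finally show ?thesis .
qed

lemma nn_integral_path_law_shift:
  assumes "x \<in> space N" "f \<in> borel_measurable \<Omega>"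
  shows "(\<integral>\<^sup>+\<omega>. f (\<lambda>i. \<omega> (Suc i)) \<partial>\<P> x) = (\<integral>\<^sup>+y. \<integral>\<^sup>+\<omega>. f \<omega> \<partial>\<P> y \<partial>K x)"
  using nn_integral_path_law_unfold[OF assms(1) measurable_compose[OF measurable_shift_Suc assms(2)]]
  by simp

lemma markov_property:
  assumes x: "x \<in> space N" and g: "\<And>i. g i \<in> borel_measurable N" and f: "f \<in> borel_measurable \<Omega>"
  shows "(\<integral>\<^sup>+\<omega>. (\<Prod>i\<le>n. g i (\<omega> i)) * f (\<lambda>i. \<omega> (n + i)) \<partial>\<P> x) =
         (\<integral>\<^sup>+\<omega>. (\<Prod>i\<le>n. g i (\<omega> i)) * (\<integral>\<^sup>+\<omega>'. f \<omega>' \<partial>\<P> (\<omega> n)) \<partial>\<P> x)"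
  using x g
proof (induction n arbitrary: x g)
  case (0 x g)
  note [measurable] = 0(2) f
  have m: "(\<lambda>\<omega>. f (case_nat x \<omega>)) \<in> borel_measurable (\<P> y)" if "y \<in> space N" for y
    by (rule measurable_path_lawI[OF that measurable_compose[OF measurable_case_nat_path[OF 0(1)] f]])
  have m': "(\<lambda>y. \<integral>\<^sup>+\<omega>. f (case_nat x \<omega>) \<partial>\<P> y) \<in> borel_measurable (K x)"
    by (rule measurable_kernelI[OF 0(1) nn_integral_path_law_measurable[OF
          measurable_compose[OF measurable_case_nat_path[OF 0(1)] f]]])
  have "(\<integral>\<^sup>+\<omega>. (\<Prod>i\<le>0. g i (\<omega> i)) * f (\<lambda>i. \<omega> (0 + i)) \<partial>\<P> x) = (\<integral>\<^sup>+\<omega>. g 0 (\<omega> 0) * f \<omega> \<partial>\<P> x)"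
    by simp
  also have "\<dots> = (\<integral>\<^sup>+y. \<integral>\<^sup>+\<omega>. g 0 x * f (case_nat x \<omega>) \<partial>\<P> y \<partial>K x)"
    using 0(1) by (subst nn_integral_path_law_unfold) auto
  also have "\<dots> = (\<integral>\<^sup>+y. g 0 x * (\<integral>\<^sup>+\<omega>. f (case_nat x \<omega>) \<partial>\<P> y) \<partial>K x)"
    using 0(1) by (intro nn_integral_cong nn_integral_cmult m) simp
  also have "\<dots> = g 0 x * (\<integral>\<^sup>+y. \<integral>\<^sup>+\<omega>. f (case_nat x \<omega>) \<partial>\<P> y \<partial>K x)"
    by (intro nn_integral_cmult m')
  also have "\<dots> = g 0 x * (\<integral>\<^sup>+\<omega>. f \<omega> \<partial>\<P> x)"
    unfolding nn_integral_path_law_unfold[OF 0(1) f] ..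
  also have "\<dots> = (\<integral>\<^sup>+\<omega>. g 0 (\<omega> 0) * (\<integral>\<^sup>+\<omega>'. f \<omega>' \<partial>\<P> (\<omega> 0)) \<partial>\<P> x)"
    using 0(1) by (subst path_law_start[where f="\<lambda>z. g 0 z * (\<integral>\<^sup>+\<omega>'. f \<omega>' \<partial>\<P> z)"]) auto
  finally show ?case by simp
next
  case (Suc n x g)
  note [measurable] = Suc(3) f
  let ?A = "\<lambda>\<omega>. (\<Prod>i\<le>n. g (Suc i) (\<omega> i)) * f (\<lambda>i. \<omega> (n + i))"
  let ?B = "\<lambda>\<omega>. (\<Prod>i\<le>n. g (Suc i) (\<omega> i)) * (\<integral>\<^sup>+\<omega>'. f \<omega>' \<partial>\<P> (\<omega> n))"
  have prod_meas: "(\<lambda>\<omega>. \<Prod>i\<le>m. g' i (\<omega> i)) \<in> borel_measurable \<Omega>"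
    if "\<And>i. g' i \<in> borel_measurable N" for m and g' :: "nat \<Rightarrow> 'z \<Rightarrow> ennreal"
    using that by measurable
  have meas_A: "(\<lambda>\<omega>. (\<Prod>i\<le>m. g' i (\<omega> i)) * f (\<lambda>i. \<omega> (m + i))) \<in> borel_measurable \<Omega>"
    and meas_B: "(\<lambda>\<omega>. (\<Prod>i\<le>m. g' i (\<omega> i)) * (\<integral>\<^sup>+\<omega>'. f \<omega>' \<partial>\<P> (\<omega> m))) \<in> borel_measurable \<Omega>"
    if "\<And>i. g' i \<in> borel_measurable N" for m and g' :: "nat \<Rightarrow> 'z \<Rightarrow> ennreal"
    by (rule borel_measurable_times_ennreal[OF prod_meas[OF that] measurable_compose[OF measurable_shift f]],
        rule borel_measurable_times_ennreal[OF prod_meas[OF that] measurable_compose[OF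
          measurable_component nn_integral_path_law_measurable[OF f]]])
  note m1 = meas_A[of g "Suc n", OF Suc(3)] and m2 = meas_B[of g "Suc n", OF Suc(3)]
  have meas: "?A \<in> borel_measurable (\<P> y)" "?B \<in> borel_measurable (\<P> y)" if "y \<in> space N" for y
    by (rule measurable_path_lawI[OF that meas_A[OF Suc(3)]], rule measurable_path_lawI[OF that meas_B[OF Suc(3)]])
  have "(\<integral>\<^sup>+\<omega>. (\<Prod>i\<le>Suc n. g i (\<omega> i)) * f (\<lambda>i. \<omega> (Suc n + i)) \<partial>\<P> x) =
      (\<integral>\<^sup>+y. \<integral>\<^sup>+\<omega>. g 0 x * ?A \<omega> \<partial>\<P> y \<partial>K x)"
    by (subst nn_integral_path_law_unfold[OF Suc(2) m1])
      (simp add: prod.atMost_Suc_shift mult.assoc del: prod.atMost_Suc)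
  also have "\<dots> = (\<integral>\<^sup>+y. g 0 x * (\<integral>\<^sup>+\<omega>. ?A \<omega> \<partial>\<P> y) \<partial>K x)"
    using Suc(2) by (intro nn_integral_cong nn_integral_cmult meas) simp
  also have "\<dots> = (\<integral>\<^sup>+y. g 0 x * (\<integral>\<^sup>+\<omega>. ?B \<omega> \<partial>\<P> y) \<partial>K x)"
    using Suc(2) by (intro nn_integral_cong arg_cong2[where f="(*)"] refl Suc.IH) auto
  also have "\<dots> = (\<integral>\<^sup>+y. \<integral>\<^sup>+\<omega>. g 0 x * ?B \<omega> \<partial>\<P> y \<partial>K x)"
    using Suc(2) by (intro nn_integral_cong nn_integral_cmult[symmetric] meas) simp
  also have "\<dots> = (\<integral>\<^sup>+\<omega>. (\<Prod>i\<le>Suc n. g i (\<omega> i)) * (\<integral>\<^sup>+\<omega>'. f \<omega>' \<partial>\<P> (\<omega> (Suc n))) \<partial>\<P> x)"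
    by (subst nn_integral_path_law_unfold[OF Suc(2) m2])
      (simp add: prod.atMost_Suc_shift mult.assoc del: prod.atMost_Suc)
  finally show ?case .
qed

lemma markov_property_at:
  assumes "x \<in> space N" "g \<in> borel_measurable N" "f \<in> borel_measurable \<Omega>"
  shows "(\<integral>\<^sup>+\<omega>. g (\<omega> n) * f (\<lambda>i. \<omega> (n + i)) \<partial>\<P> x) =
         (\<integral>\<^sup>+\<omega>. g (\<omega> n) * (\<integral>\<^sup>+\<omega>'. f \<omega>' \<partial>\<P> (\<omega> n)) \<partial>\<P> x)"
proof -
  have "(\<Prod>i\<le>n. (if i = n then g else (\<lambda>_. 1)) (\<omega> i)) = g (\<omega> n)" for \<omega>
    by (simp add: lessThan_Suc_atMost[symmetric] prod.lessThan_Suc)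
  then show ?thesis
    using markov_property[of x "\<lambda>i. if i = n then g else (\<lambda>_. 1)" f n] assms by simp
qed

text \<open>
  An event on path space that does not depend on the time origin.
\<close>
definition shift_invariant :: "(nat \<Rightarrow> 'z) set \<Rightarrow> bool" where
  "shift_invariant E \<longleftrightarrow> E \<in> sets \<Omega> \<and> (\<forall>\<omega>\<in>space \<Omega>. (\<lambda>i. \<omega> (Suc i)) \<in> E \<longleftrightarrow> \<omega> \<in> E)"

lemma shift_invariantD: "shift_invariant E \<Longrightarrow> E \<in> sets \<Omega>"
  by (simp add: shift_invariant_def)

lemma shift_invariant_shift:
  assumes "shift_invariant E" "\<omega> \<in> space \<Omega>"
  shows "(\<lambda>i. \<omega> (n + i)) \<in> E \<longleftrightarrow> \<omega> \<in> E"
proof (induction n)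
  case (Suc n)
  have "(\<lambda>i. \<omega> (n + i)) \<in> space \<Omega>"
    using measurable_space[OF measurable_shift assms(2)] .
  from bspec[OF conjunct2[OF assms(1)[unfolded shift_invariant_def]] this]
  have "(\<lambda>i. \<omega> (Suc n + i)) \<in> E \<longleftrightarrow> (\<lambda>i. \<omega> (n + i)) \<in> E"
    by simp
  then show ?case
    using Suc by simp
qed simp

lemma shift_invariant_Compl: "shift_invariant E \<Longrightarrow> shift_invariant (space \<Omega> - E)"
  unfolding shift_invariant_def using measurable_space[OF measurable_shift_Suc] by blast

text \<open>
  If a shift-invariant event is null from every point of \<open>C\<close>, it is null from every point from
  which \<open>C\<close> is reached almost surely. No first hitting time is needed: for each fixed \<open>n\<close>, the
  event that \<open>\<omega> n \<in> C\<close> and \<open>\<omega> \<in> E\<close> is null by the Markov property at time \<open>n\<close>.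
\<close>
lemma null_of_hits:
  assumes E: "shift_invariant E" and C: "C \<in> sets N"
    and null: "\<And>y. y \<in> C \<Longrightarrow> emeasure (\<P> y) E = 0"
    and x: "x \<in> space N" and hit: "AE \<omega> in \<P> x. \<exists>n. \<omega> n \<in> C"
  shows "emeasure (\<P> x) E = 0"
proof -
  note [measurable] = shift_invariantD[OF E] C
  have CN: "y \<in> C \<Longrightarrow> y \<in> space N" for y
    using sets.sets_into_space[OF C] by auto
  have "AE \<omega> in \<P> x. \<not> (\<omega> n \<in> C \<and> \<omega> \<in> E)" for n
  proof -
    have "(\<integral>\<^sup>+\<omega>. indicator C (\<omega> n) * indicator E \<omega> \<partial>\<P> x) =
        (\<integral>\<^sup>+\<omega>. indicator C (\<omega> n) * indicator E (\<lambda>i. \<omega> (n + i)) \<partial>\<P> x)"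
      using x by (intro nn_integral_cong) (simp add: indicator_def shift_invariant_shift[OF E])
    also have "\<dots> = (\<integral>\<^sup>+\<omega>. indicator C (\<omega> n) * (\<integral>\<^sup>+\<omega>'. indicator E \<omega>' \<partial>\<P> (\<omega> n)) \<partial>\<P> x)"
      by (rule markov_property_at[OF x]) auto
    also have "\<dots> = (\<integral>\<^sup>+\<omega>. 0 \<partial>\<P> x)"
      using null CN by (intro nn_integral_cong) (auto split: split_indicator)
    finally have "(\<integral>\<^sup>+\<omega>. indicator C (\<omega> n) * indicator E \<omega> \<partial>\<P> x) = 0" by simp
    moreover have "(\<lambda>\<omega>. indicator C (\<omega> n) * indicator E \<omega> :: ennreal) \<in> borel_measurable (\<P> x)"
      by (rule measurable_path_lawI[OF x]) measurable
    ultimately have "AE \<omega> in \<P> x. indicator C (\<omega> n) * indicator E \<omega> = (0::ennreal)"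
      using nn_integral_0_iff_AE by blast
    then show ?thesis
      by (rule AE_mp) (auto intro!: AE_I2 split: split_indicator_asm)
  qed
  then have "AE \<omega> in \<P> x. \<forall>n. \<not> (\<omega> n \<in> C \<and> \<omega> \<in> E)"
    unfolding AE_all_countable by blast
  with hit have "AE \<omega> in \<P> x. \<omega> \<notin> E"
    by eventually_elim auto
  moreover have "{\<omega>\<in>space (\<P> x). \<not> \<omega> \<notin> E} = E"
    using sets.sets_into_space[OF shift_invariantD[OF E]] x by auto
  ultimately show ?thesis
    using AE_iff_measurable[of E "\<P> x" "\<lambda>\<omega>. \<omega> \<notin> E"] x shift_invariantD[OF E] by simp
qed

end

text \<open>
  A Markov kernel with a distinguished invariant probability measure.
\<close>
locale stationary_kernel = markov_kernel N K
  for N :: "'z measure" and K :: "'z \<Rightarrow> 'z measure" +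
  fixes \<nu> :: "'z measure"
  assumes invariant: "invariant_probability N K \<nu>"
begin

lemma prob_space_\<nu>: "prob_space \<nu>" and sets_\<nu> [simp, measurable_cong]: "sets \<nu> = sets N"
  using invariant by (auto simp: invariant_probability_def space_prob_algebra)

lemma space_\<nu> [simp]: "space \<nu> = space N"
  by (rule sets_eq_imp_space_eq) simp

sublocale \<nu>: prob_space \<nu>
  by (rule prob_space_\<nu>)

lemma nn_integral_invariant:
  assumes "f \<in> borel_measurable N"
  shows "(\<integral>\<^sup>+x. \<integral>\<^sup>+y. f y \<partial>K x \<partial>\<nu>) = (\<integral>\<^sup>+x. f x \<partial>\<nu>)"
proof -
  have "(\<integral>\<^sup>+x. f x \<partial>(\<nu> \<bind> K)) = (\<integral>\<^sup>+x. \<integral>\<^sup>+y. f y \<partial>K x \<partial>\<nu>)"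
    using assms by (intro nn_integral_bind[where B=N]) auto
  then show ?thesis
    using invariant by (simp add: invariant_probability_def)
qed

text \<open>
  The law on path space of the chain with initial distribution \<open>\<nu>\<close>; it is invariant under the
  shift because \<open>\<nu>\<close> is invariant under \<open>K\<close>.
\<close>
definition stationary_law :: "(nat \<Rightarrow> 'z) measure" (\<open>\<P>\<^sub>\<nu>\<close>) where
  "stationary_law = \<nu> \<bind> \<P>"

lemma measurable_path_law_\<nu>: "\<P> \<in> \<nu> \<rightarrow>\<^sub>M subprob_algebra \<Omega>"
  by measurable

lemma sets_stationary_law [simp, measurable_cong]: "sets \<P>\<^sub>\<nu> = sets \<Omega>"
  unfolding stationary_law_def using \<nu>.not_empty by (intro sets_bind) auto

lemma space_stationary_law [simp]: "space \<P>\<^sub>\<nu> = space \<Omega>"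
  by (rule sets_eq_imp_space_eq) simp

sublocale \<P>\<nu>: prob_space "\<P>\<^sub>\<nu>"
  unfolding stationary_law_def
  by (rule \<nu>.prob_space_bind[OF _ measurable_path_law_\<nu>]) (auto simp: prob_space_path_law)

lemma nn_integral_stationary_law:
  "f \<in> borel_measurable \<Omega> \<Longrightarrow> (\<integral>\<^sup>+\<omega>. f \<omega> \<partial>\<P>\<^sub>\<nu>) = (\<integral>\<^sup>+x. \<integral>\<^sup>+\<omega>. f \<omega> \<partial>\<P> x \<partial>\<nu>)"
  unfolding stationary_law_def by (rule nn_integral_bind[OF _ measurable_path_law_\<nu>])

lemma AE_stationary_lawI:
  assumes [measurable]: "Measurable.pred \<Omega> Q" and ae: "\<And>x. x \<in> space N \<Longrightarrow> AE \<omega> in \<P> x. Q \<omega>"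
  shows "AE \<omega> in \<P>\<^sub>\<nu>. Q \<omega>"
  unfolding stationary_law_def
  by (subst AE_bind[OF measurable_path_law_\<nu>]) (fact, intro AE_I2 ae, simp)

lemma nn_integral_stationary_law_shift:
  assumes [measurable]: "f \<in> borel_measurable \<Omega>"
  shows "(\<integral>\<^sup>+\<omega>. f (\<lambda>i. \<omega> (Suc i)) \<partial>\<P>\<^sub>\<nu>) = (\<integral>\<^sup>+\<omega>. f \<omega> \<partial>\<P>\<^sub>\<nu>)"
proof -
  have "(\<integral>\<^sup>+\<omega>. f (\<lambda>i. \<omega> (Suc i)) \<partial>\<P>\<^sub>\<nu>) = (\<integral>\<^sup>+x. \<integral>\<^sup>+y. \<integral>\<^sup>+\<omega>. f \<omega> \<partial>\<P> y \<partial>K x \<partial>\<nu>)"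
    unfolding nn_integral_stationary_law[OF measurable_compose[OF measurable_shift_Suc assms]]
    by (intro nn_integral_cong nn_integral_path_law_shift assms) simp
  also have "\<dots> = (\<integral>\<^sup>+\<omega>. f \<omega> \<partial>\<P>\<^sub>\<nu>)"
    unfolding nn_integral_stationary_law[OF assms]
    by (rule nn_integral_invariant[OF nn_integral_path_law_measurable[OF assms]])
  finally show ?thesis .
qed

lemma distr_stationary_law_shift: "distr \<P>\<^sub>\<nu> \<Omega> (\<lambda>\<omega> i. \<omega> (Suc i)) = \<P>\<^sub>\<nu>"
proof (rule measure_eqI)
  fix A assume "A \<in> sets (distr \<P>\<^sub>\<nu> \<Omega> (\<lambda>\<omega> i. \<omega> (Suc i)))"
  then have [measurable]: "A \<in> sets \<Omega>" by simp
  have m: "(\<lambda>\<omega> i. \<omega> (Suc i)) \<in> \<P>\<^sub>\<nu> \<rightarrow>\<^sub>M \<Omega>"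
    by (subst measurable_cong_sets[OF sets_stationary_law refl]) (rule measurable_shift_Suc)
  have "emeasure (distr \<P>\<^sub>\<nu> \<Omega> (\<lambda>\<omega> i. \<omega> (Suc i))) A =
      (\<integral>\<^sup>+\<omega>. indicator A \<omega> \<partial>distr \<P>\<^sub>\<nu> \<Omega> (\<lambda>\<omega> i. \<omega> (Suc i)))"
    by simp
  also have "\<dots> = (\<integral>\<^sup>+\<omega>. indicator A (\<lambda>i. \<omega> (Suc i)) \<partial>\<P>\<^sub>\<nu>)"
    by (rule nn_integral_distr[OF m]) simp
  also have "\<dots> = (\<integral>\<^sup>+\<omega>. indicator A \<omega> \<partial>\<P>\<^sub>\<nu>)"
    by (rule nn_integral_stationary_law_shift) simp
  also have "\<dots> = emeasure \<P>\<^sub>\<nu> A"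
    by simp
  finally show "emeasure (distr \<P>\<^sub>\<nu> \<Omega> (\<lambda>\<omega> i. \<omega> (Suc i))) A = emeasure \<P>\<^sub>\<nu> A" .
qed simp

lemma nn_integral_stationary_law_component:
  assumes [measurable]: "f \<in> borel_measurable N"
  shows "(\<integral>\<^sup>+\<omega>. f (\<omega> n) \<partial>\<P>\<^sub>\<nu>) = (\<integral>\<^sup>+x. f x \<partial>\<nu>)"
proof (induction n)
  case 0
  have "(\<integral>\<^sup>+\<omega>. f (\<omega> 0) \<partial>\<P>\<^sub>\<nu>) = (\<integral>\<^sup>+x. \<integral>\<^sup>+\<omega>. f (\<omega> 0) \<partial>\<P> x \<partial>\<nu>)"
    by (rule nn_integral_stationary_law) simp
  also have "\<dots> = (\<integral>\<^sup>+x. f x \<partial>\<nu>)"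
    by (intro nn_integral_cong path_law_start assms) simp
  finally show ?case .
next
  case (Suc n)
  then show ?case
    using nn_integral_stationary_law_shift[of "\<lambda>\<omega>. f (\<omega> n)"] by simp
qed

lemma distr_stationary_law_component: "distr \<P>\<^sub>\<nu> N (\<lambda>\<omega>. \<omega> n) = \<nu>"
proof (rule measure_eqI)
  fix A assume "A \<in> sets (distr \<P>\<^sub>\<nu> N (\<lambda>\<omega>. \<omega> n))"
  then have [measurable]: "A \<in> sets N" by simp
  have "emeasure (distr \<P>\<^sub>\<nu> N (\<lambda>\<omega>. \<omega> n)) A = (\<integral>\<^sup>+x. indicator A x \<partial>distr \<P>\<^sub>\<nu> N (\<lambda>\<omega>. \<omega> n))"
    by simp
  also have "\<dots> = (\<integral>\<^sup>+\<omega>. indicator A (\<omega> n) \<partial>\<P>\<^sub>\<nu>)"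
    by (rule nn_integral_distr) simp_all
  finally show "emeasure (distr \<P>\<^sub>\<nu> N (\<lambda>\<omega>. \<omega> n)) A = emeasure \<nu> A"
    by (simp add: nn_integral_stationary_law_component)
qed simp

lemma borel_measurable_emeasure_path_law [measurable]:
  "E \<in> sets \<Omega> \<Longrightarrow> (\<lambda>x. emeasure (\<P> x) E) \<in> borel_measurable N"
  by measurable

lemma emeasure_stationary_law:
  "E \<in> sets \<Omega> \<Longrightarrow> emeasure \<P>\<^sub>\<nu> E = (\<integral>\<^sup>+x. emeasure (\<P> x) E \<partial>\<nu>)"
  unfolding stationary_law_def using \<nu>.not_empty by (intro emeasure_bind[OF _ measurable_path_law_\<nu>]) auto

lemma stationary_markov:
  assumes E: "shift_invariant E" and [measurable]: "\<And>i. g i \<in> borel_measurable N"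
  shows "(\<integral>\<^sup>+\<omega>. (\<Prod>i\<le>n. g i (\<omega> i)) * indicator E \<omega> \<partial>\<P>\<^sub>\<nu>) =
         (\<integral>\<^sup>+\<omega>. (\<Prod>i\<le>n. g i (\<omega> i)) * emeasure (\<P> (\<omega> n)) E \<partial>\<P>\<^sub>\<nu>)"
proof -
  note [measurable] = shift_invariantD[OF E]
  have "(\<integral>\<^sup>+\<omega>. (\<Prod>i\<le>n. g i (\<omega> i)) * indicator E \<omega> \<partial>\<P> x) =
      (\<integral>\<^sup>+\<omega>. (\<Prod>i\<le>n. g i (\<omega> i)) * emeasure (\<P> (\<omega> n)) E \<partial>\<P> x)" if x: "x \<in> space N" for x
  proof -
    have "(\<integral>\<^sup>+\<omega>. (\<Prod>i\<le>n. g i (\<omega> i)) * indicator E \<omega> \<partial>\<P> x) =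
        (\<integral>\<^sup>+\<omega>. (\<Prod>i\<le>n. g i (\<omega> i)) * indicator E (\<lambda>i. \<omega> (n + i)) \<partial>\<P> x)"
      using x by (intro nn_integral_cong) (simp add: indicator_def shift_invariant_shift[OF E])
    also have "\<dots> = (\<integral>\<^sup>+\<omega>. (\<Prod>i\<le>n. g i (\<omega> i)) * (\<integral>\<^sup>+\<omega>'. indicator E \<omega>' \<partial>\<P> (\<omega> n)) \<partial>\<P> x)"
      by (rule markov_property[OF x]) auto
    also have "\<dots> = (\<integral>\<^sup>+\<omega>. (\<Prod>i\<le>n. g i (\<omega> i)) * emeasure (\<P> (\<omega> n)) E \<partial>\<P> x)"
      using x by (intro nn_integral_cong) (auto simp: space_PiM PiE_iff nn_integral_path_law_indicator)
    finally show ?thesis .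
  qed
  then show ?thesis
    by (subst (1 2) nn_integral_stationary_law) (auto intro: nn_integral_cong)
qed

text \<open>
  A weak form of Levy's zero-one law. By the Markov property \<open>\<P> (\<omega> n) E\<close> is the conditional
  probability of \<open>E\<close> given the first \<open>n\<close> steps, so for a cylinder \<open>A\<close> the integrals are
  eventually equal to the limit; a \<open>\<lambda>\<close>-system argument extends the convergence to all events.
\<close>
lemma tendsto_path_probability:
  assumes E: "shift_invariant E" and A: "A \<in> sets \<Omega>"
  shows "(\<lambda>n. \<integral>\<^sup>+\<omega>. indicator A \<omega> * emeasure (\<P> (\<omega> n)) E \<partial>\<P>\<^sub>\<nu>) \<longlonglongrightarrow> emeasure \<P>\<^sub>\<nu> (A \<inter> E)"
proof -
  note Em [measurable] = shift_invariantD[OF E]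
  define \<kappa> where "\<kappa> n = density \<P>\<^sub>\<nu> (\<lambda>\<omega>. emeasure (\<P> (\<omega> n)) E)" for n
  define \<kappa>' where "\<kappa>' = density \<P>\<^sub>\<nu> (indicator E)"
  have h_le: "emeasure (\<P> x) E \<le> 1" if "x \<in> space N" for x
    using that by (intro subprob_space.subprob_emeasure_le_1 prob_space_imp_subprob_space prob_space_path_law)
  have \<kappa>: "emeasure (\<kappa> n) B = (\<integral>\<^sup>+\<omega>. indicator B \<omega> * emeasure (\<P> (\<omega> n)) E \<partial>\<P>\<^sub>\<nu>)"
    if "B \<in> sets \<Omega>" for B n
    using that unfolding \<kappa>_def by (subst emeasure_density) (auto simp: mult.commute)
  have \<kappa>_eq: "emeasure (\<kappa>' ) B = emeasure \<P>\<^sub>\<nu> (B \<inter> E)" if "B \<in> sets \<Omega>" for B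
    using that unfolding \<kappa>'_def
    by (subst emeasure_density) (auto simp: indicator_inter_arith[symmetric] Int_commute)
  have sets_\<kappa> [simp]: "sets (\<kappa> n) = sets \<Omega>" "sets \<kappa>' = sets \<Omega>" 
    and space_\<kappa> [simp]: "space (\<kappa> n) = space \<Omega>" "space \<kappa>' = space \<Omega>" for n
    by (simp_all add: \<kappa>_def \<kappa>'_def)
  have \<kappa>_le: "emeasure (\<kappa> n) B \<le> emeasure \<P>\<^sub>\<nu> B" if B: "B \<in> sets \<Omega>" for B n
  proof -
    have "emeasure (\<kappa> n) B \<le> (\<integral>\<^sup>+\<omega>. indicator B \<omega> \<partial>\<P>\<^sub>\<nu>)"
      unfolding \<kappa>[OF B] using h_le
      by (intro nn_integral_mono) (auto split: split_indicator simp: space_PiM)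
    then show ?thesis using B by simp
  qed
  have total: "emeasure (\<kappa> n) (space \<Omega>) = emeasure \<kappa>' (space \<Omega>)" for n
  proof -
    have "emeasure (\<kappa> n) (space \<Omega>) = (\<integral>\<^sup>+\<omega>. (\<Prod>i\<le>n. 1) * emeasure (\<P> (\<omega> n)) E \<partial>\<P>\<^sub>\<nu>)"
      unfolding \<kappa>[OF sets.top] by (intro nn_integral_cong) simp
    also have "\<dots> = (\<integral>\<^sup>+\<omega>. (\<Prod>i\<le>n. 1) * indicator E \<omega> \<partial>\<P>\<^sub>\<nu>)"
      by (rule stationary_markov[OF E, symmetric]) simp
    also have "\<dots> = emeasure \<kappa>' (space \<Omega>)"
      using sets.sets_into_space[OF Em] by (simp add: \<kappa>_eq Int_absorb1)
    finally show ?thesis .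
  qed
  have fin: "emeasure (\<kappa> n) B \<noteq> \<infinity>" if "B \<in> sets \<Omega>" for B n
    using \<kappa>_le[OF that, of n] \<P>\<nu>.emeasure_finite[of B] by (auto simp: top_unique)
  have fin': "emeasure \<kappa>' B \<noteq> \<infinity>" if "B \<in> sets \<Omega>" for B
    using \<kappa>_eq[OF that] by simp
  have "A \<in> sigma_sets (space \<Omega>) cylinders"
    using A sets_\<Omega> by simp
  then have "(\<lambda>n. emeasure (\<kappa> n) A) \<longlonglongrightarrow> emeasure \<kappa>' A"
  proof (induction rule: sigma_sets_induct_disjoint[OF Int_stable_cylinders cylinders_subset, consumes 1, case_names basic empty compl union])
    case (basic A)
    then obtain m B where A: "A = cylinder m B" and B: "\<And>i. B i \<in> sets N"
      unfolding cylinders_def by blast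
    have "emeasure (\<kappa> n) A = emeasure \<kappa>' A" if "m \<le> n" for n
    proof -
      let ?B = "\<lambda>i. if i \<le> m then B i else space N"
      have An: "A = cylinder n ?B"
        unfolding A by (rule cylinder_extend[OF B that])
      have Am: "A \<in> sets \<Omega>" unfolding A using B by measurable
      have "emeasure (\<kappa> n) A = (\<integral>\<^sup>+\<omega>. (\<Prod>i\<le>n. indicator (?B i) (\<omega> i)) * emeasure (\<P> (\<omega> n)) E \<partial>\<P>\<^sub>\<nu>)"
        unfolding \<kappa>[OF Am] unfolding An by (intro nn_integral_cong) (simp add: indicator_cylinder)
      also have "\<dots> = (\<integral>\<^sup>+\<omega>. (\<Prod>i\<le>n. indicator (?B i) (\<omega> i)) * indicator E \<omega> \<partial>\<P>\<^sub>\<nu>)"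
        using B by (intro stationary_markov[OF E, symmetric]) auto
      also have "\<dots> = (\<integral>\<^sup>+\<omega>. indicator (A \<inter> E) \<omega> \<partial>\<P>\<^sub>\<nu>)"
        unfolding An by (intro nn_integral_cong) (simp add: indicator_cylinder indicator_inter_arith)
      finally show ?thesis
        using Am by (simp add: \<kappa>_eq)
    qed
    then show ?case
      by (intro tendsto_eventually) (auto simp: eventually_sequentially)
  next
    case empty
    show ?case by simp
  next
    case (compl A)
    then have A: "A \<in> sets \<Omega>" using sets_\<Omega> by simp
    have "emeasure (\<kappa> n) (space \<Omega> - A) = emeasure \<kappa>' (space \<Omega>) - emeasure (\<kappa> n) A" for n
      using emeasure_compl[of A "\<kappa> n"] A fin[OF A] total[of n] by simp
    moreover have "emeasure \<kappa>' (space \<Omega> - A) = emeasure \<kappa>' (space \<Omega>) - emeasure \<kappa>' A"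
      using emeasure_compl[of A "\<kappa>'"] A fin'[OF A] by simp
    moreover have "(\<lambda>n. emeasure \<kappa>' (space \<Omega>) - emeasure (\<kappa> n) A) \<longlonglongrightarrow> emeasure \<kappa>' (space \<Omega>) - emeasure \<kappa>' A"
      using compl fin'[of "space \<Omega>"] fin'[OF A] by (intro tendsto_diff_ennreal tendsto_const) auto
    ultimately show ?case by simp
  next
    case (union A)
    then have A: "\<And>i. A i \<in> sets \<Omega>" using sets_\<Omega> by auto
    have sum_eq: "emeasure \<mu> (\<Union>i. A i) = (\<integral>\<^sup>+i. emeasure \<mu> (A i) \<partial>count_space UNIV)"
      if "sets \<mu> = sets \<Omega>" for \<mu>
      using suminf_emeasure[of A \<mu>, symmetric] A that \<open>disjoint_family A\<close>
      by (simp add: nn_integral_count_space_nat image_subset_iff)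
    \<comment> \<open>dominated convergence over the index of the disjoint union, with dominating terms \<open>\<P>\<^sub>\<nu> (A i)\<close>\<close>
    have "(\<lambda>n. \<integral>\<^sup>+i. emeasure (\<kappa> n) (A i) \<partial>count_space UNIV)
        \<longlonglongrightarrow> (\<integral>\<^sup>+i. emeasure \<kappa>' (A i) \<partial>count_space UNIV)"
    proof (rule nn_integral_dominated_convergence)
      show "(\<integral>\<^sup>+i. emeasure \<P>\<^sub>\<nu> (A i) \<partial>count_space UNIV) < \<infinity>"
        using \<P>\<nu>.emeasure_finite[of "\<Union>i. A i"] by (simp add: sum_eq[symmetric] less_top[symmetric])
    qed (use union \<kappa>_le A in auto)
    then show ?case
      by (simp add: sum_eq)
  qed
  then show ?thesis
    using A by (simp add: \<kappa> \<kappa>_eq)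
qed

text \<open>
  With \<open>A = E\<close> the integrals in the previous lemma do not depend on \<open>n\<close>: writing \<open>h x\<close> for
  \<open>\<P> x E\<close>, they all equal \<open>\<integral> h\<^sup>2 d\<nu>\<close>, while the limit is \<open>\<integral> h d\<nu>\<close>. Hence \<open>h\<^sup>2 = h\<close>
  almost everywhere.
\<close>
lemma stationary_zero_one:
  assumes E: "shift_invariant E"
  shows "AE x in \<nu>. emeasure (\<P> x) E = 0 \<or> emeasure (\<P> x) E = 1"
proof -
  note Em [measurable] = shift_invariantD[OF E]
  let ?h = "\<lambda>x. emeasure (\<P> x) E"
  have h_le: "?h x \<le> 1" if "x \<in> space N" for x
    using that by (intro subprob_space.subprob_emeasure_le_1 prob_space_imp_subprob_space prob_space_path_law)
  have "(\<integral>\<^sup>+\<omega>. indicator E \<omega> * ?h (\<omega> n) \<partial>\<P>\<^sub>\<nu>) = (\<integral>\<^sup>+x. ?h x * ?h x \<partial>\<nu>)" for n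
  proof -
    let ?g = "\<lambda>i. if i = n then ?h else (\<lambda>_. 1)"
    have p: "(\<Prod>i\<le>n. ?g i (\<omega> i)) = ?h (\<omega> n)" for \<omega>
      by (simp add: lessThan_Suc_atMost[symmetric] prod.lessThan_Suc)
    have "(\<integral>\<^sup>+\<omega>. ?h (\<omega> n) * indicator E \<omega> \<partial>\<P>\<^sub>\<nu>) = (\<integral>\<^sup>+\<omega>. ?h (\<omega> n) * ?h (\<omega> n) \<partial>\<P>\<^sub>\<nu>)"
      using stationary_markov[OF E, of ?g n] unfolding p by simp
    also have "\<dots> = (\<integral>\<^sup>+x. ?h x * ?h x \<partial>\<nu>)"
      by (rule nn_integral_stationary_law_component) measurable
    finally show ?thesis by (simp add: mult.commute)
  qed
  then have "(\<lambda>n. \<integral>\<^sup>+x. ?h x * ?h x \<partial>\<nu>) \<longlonglongrightarrow> emeasure \<P>\<^sub>\<nu> (E \<inter> E)"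
    using tendsto_path_probability[OF E Em] by simp
  then have eq: "(\<integral>\<^sup>+x. ?h x * ?h x \<partial>\<nu>) = (\<integral>\<^sup>+x. ?h x \<partial>\<nu>)"
    using LIMSEQ_const_iff emeasure_stationary_law[OF Em] by auto
  have fin: "(\<integral>\<^sup>+x. ?h x * ?h x \<partial>\<nu>) \<noteq> \<infinity>"
    unfolding eq emeasure_stationary_law[OF Em, symmetric] by simp
  have sq_le: "?h x * ?h x \<le> ?h x" if "x \<in> space N" for x
    using mult_left_mono[OF h_le[OF that], of "?h x"] by simp
  have "(\<integral>\<^sup>+x. ?h x - ?h x * ?h x \<partial>\<nu>) = (\<integral>\<^sup>+x. ?h x \<partial>\<nu>) - (\<integral>\<^sup>+x. ?h x * ?h x \<partial>\<nu>)"
    using fin sq_le by (intro nn_integral_diff) auto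
  also have "\<dots> = 0"
    using fin eq by simp
  finally have "AE x in \<nu>. ?h x - ?h x * ?h x = 0"
    by (subst (asm) nn_integral_0_iff_AE) auto
  then show ?thesis
  proof (rule AE_mp, intro AE_I2 impI)
    fix x assume "x \<in> space \<nu>" and 0: "?h x - ?h x * ?h x = 0"
    then have le: "?h x \<le> 1" using h_le by simp
    then obtain r where r: "?h x = ennreal r" "0 \<le> r" "r \<le> 1"
      by (cases "?h x") (auto simp: top_unique)
    from 0 have "r - r * r \<le> 0"
      using r by (simp add: ennreal_mult[symmetric] ennreal_minus ennreal_eq_0_iff)
    then have "r * (1 - r) \<le> 0" by (simp add: algebra_simps)
    then have "r = 0 \<or> r = 1"
      using r by (auto simp: mult_le_0_iff)
    then show "?h x = 0 \<or> ?h x = 1" using r by auto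
  qed
qed

end

text \<open>
  A positive Harris recurrent kernel with invariant probability measure \<open>\<nu>\<close>.
\<close>
locale harris_kernel = stationary_kernel N K \<nu>
  for N :: "'z measure" and K :: "'z \<Rightarrow> 'z measure" and \<nu> :: "'z measure" +
  assumes harris: "harris_recurrent N K"
begin

text \<open>
  Under the Harris condition the dichotomy holds at every starting point, with the same
  alternative for all of them. The Harris measure \<open>\<phi>\<close> is absolutely continuous with respect to
  \<open>\<nu>\<close>, hence charges one of the sets \<open>C 0\<close> and \<open>C 1\<close> where \<open>\<P> x E\<close> is \<open>0\<close> or \<open>1\<close>; that set
  is then reached from everywhere.
\<close>
lemma shift_invariant_trivial:
  assumes E: "shift_invariant E"
  shows "(\<forall>x\<in>space N. emeasure (\<P> x) E = 0) \<or> (\<forall>x\<in>space N. emeasure (\<P> x) E = 1)"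
proof -
  note Em [measurable] = shift_invariantD[OF E]
  obtain \<phi> where \<phi>: "sets \<phi> = sets N" "emeasure \<phi> (space N) > 0"
    and hit: "\<And>B x. B \<in> sets N \<Longrightarrow> emeasure \<phi> B > 0 \<Longrightarrow> x \<in> space N \<Longrightarrow> AE \<omega> in \<P> x. \<exists>\<^sub>\<infinity>t. \<omega> t \<in> B"
    using harris unfolding harris_recurrent_def by metis
  have hits: "AE \<omega> in \<P> x. \<exists>t. \<omega> t \<in> B" if "B \<in> sets N" "emeasure \<phi> B > 0" "x \<in> space N" for B x
    using hit[OF that] by eventually_elim (auto dest: INFM_EX)
  \<comment> \<open>a \<open>\<nu>\<close>-null set is almost surely never visited by the stationary chain, so \<open>\<phi>\<close> cannot charge it\<close>
  have ac: "emeasure \<phi> B = 0" if B: "B \<in> sets N" and "emeasure \<nu> B = 0" for B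
  proof (rule ccontr)
    note [measurable] = B
    assume "emeasure \<phi> B \<noteq> 0"
    then have "AE \<omega> in \<P>\<^sub>\<nu>. \<exists>t. \<omega> t \<in> B"
      using hits[OF B] by (intro AE_stationary_lawI) (auto simp: zero_less_iff_neq_zero)
    moreover have "AE \<omega> in \<P>\<^sub>\<nu>. \<omega> t \<notin> B" for t
    proof -
      have "(\<integral>\<^sup>+\<omega>. indicator B (\<omega> t) \<partial>\<P>\<^sub>\<nu>) = 0"
        using nn_integral_stationary_law_component[of "indicator B" t] that by simp
      then have "AE \<omega> in \<P>\<^sub>\<nu>. indicator B (\<omega> t) = (0::ennreal)"
        by (subst (asm) nn_integral_0_iff_AE) auto
      then show ?thesis
        by eventually_elim (auto split: split_indicator_asm)
    qed
    then have "AE \<omega> in \<P>\<^sub>\<nu>. \<forall>t. \<omega> t \<notin> B"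
      by (simp add: AE_all_countable)
    ultimately have "AE \<omega> in \<P>\<^sub>\<nu>. False"
      by eventually_elim auto
    then show False by simp
  qed
  define C where "C r = {x\<in>space N. emeasure (\<P> x) E = r}" for r
  have C [measurable]: "C r \<in> sets N" for r
    unfolding C_def by measurable
  have "AE x in \<nu>. x \<in> C 0 \<union> C 1"
    using stationary_zero_one[OF E] by (auto simp: C_def)
  then have "emeasure \<nu> (space N - (C 0 \<union> C 1)) = 0"
    by (subst (asm) AE_iff_measurable[OF _ refl]) (auto simp: set_diff_eq)
  then have "emeasure \<phi> (space N - (C 0 \<union> C 1)) = 0"
    by (intro ac) auto
  moreover have "emeasure \<phi> (space N) \<le> emeasure \<phi> (C 0) + emeasure \<phi> (C 1) + emeasure \<phi> (space N - (C 0 \<union> C 1))"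
  proof -
    have "emeasure \<phi> (space N) \<le> emeasure \<phi> ((C 0 \<union> C 1) \<union> (space N - (C 0 \<union> C 1)))"
      using \<phi> by (intro emeasure_mono) auto
    also have "\<dots> \<le> emeasure \<phi> (C 0 \<union> C 1) + emeasure \<phi> (space N - (C 0 \<union> C 1))"
      using \<phi> by (intro emeasure_subadditive) auto
    also have "\<dots> \<le> emeasure \<phi> (C 0) + emeasure \<phi> (C 1) + emeasure \<phi> (space N - (C 0 \<union> C 1))"
      using \<phi> by (intro add_mono emeasure_subadditive) auto
    finally show ?thesis .
  qed
  ultimately have "emeasure \<phi> (C 0) + emeasure \<phi> (C 1) > 0"
    using \<phi> by (auto simp: zero_less_iff_neq_zero)
  then consider "emeasure \<phi> (C 0) > 0" | "emeasure \<phi> (C 1) > 0"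
    by (auto simp: zero_less_iff_neq_zero)
  then show ?thesis
  proof cases
    case 1
    have "emeasure (\<P> x) E = 0" if "x \<in> space N" for x
      by (rule null_of_hits[OF E C _ that hits[OF C 1 that]]) (simp add: C_def)
    then show ?thesis by simp
  next
    case 2
    have compl: "emeasure (\<P> x) (space \<Omega> - E) = 1 - emeasure (\<P> x) E" if x: "x \<in> space N" for x
    proof -
      interpret P: prob_space "\<P> x" by (rule prob_space_path_law[OF x])
      show ?thesis
        using emeasure_compl[of E "\<P> x"] x P.emeasure_space_1 by simp
    qed
    have "emeasure (\<P> x) E = 1" if x: "x \<in> space N" for x
    proof -
      interpret P: prob_space "\<P> x" by (rule prob_space_path_law[OF x])
      have "emeasure (\<P> x) (space \<Omega> - E) = 0"
        by (rule null_of_hits[OF shift_invariant_Compl[OF E] C _ x hits[OF C 2 x]])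
          (simp add: C_def compl)
      then have "1 - emeasure (\<P> x) E = 0" using compl[OF x] by simp
      then show ?thesis
        using P.emeasure_le_1[of E] by (intro antisym) (auto simp: diff_eq_0_iff_ennreal)
    qed
    then show ?thesis by simp
  qed
qed

end

section \<open>Path averages of a Harris recurrent chain\<close>

context markov_kernel
begin

text \<open>
  The maximum of the partial sums \<open>\<Sum>i<k. f (\<omega> i)\<close> over \<open>k \<le> n\<close> (with \<open>0\<close> for \<open>k = 0\<close>), in the
  recursive form in which Garsia's proof of the maximal ergodic lemma uses it.
\<close>
primrec max_partial_sum :: "('z \<Rightarrow> real) \<Rightarrow> nat \<Rightarrow> (nat \<Rightarrow> 'z) \<Rightarrow> real" where
  "max_partial_sum f 0 \<omega> = 0"
| "max_partial_sum f (Suc n) \<omega> = max 0 (f (\<omega> 0) + max_partial_sum f n (\<lambda>i. \<omega> (Suc i)))"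

lemma max_partial_sum_nonneg: "0 \<le> max_partial_sum f n \<omega>"
  by (cases n) auto

lemma max_partial_sum_mono: "max_partial_sum f n \<omega> \<le> max_partial_sum f (Suc n) \<omega>"
proof (induction n arbitrary: \<omega>)
  case 0
  show ?case by simp
next
  case (Suc n)
  show ?case
    using Suc.IH[of "\<lambda>i. \<omega> (Suc i)"] by (auto simp: max_def)
qed

lemma partial_sum_le_max_partial_sum:
  "k \<le> n \<Longrightarrow> (\<Sum>i<k. f (\<omega> i)) \<le> max_partial_sum f n \<omega>"
proof (induction n arbitrary: k \<omega>)
  case 0
  then show ?case by simp
next
  case (Suc n)
  show ?case
  proof (cases k)
    case 0
    then show ?thesis by simp
  next
    case (Suc j)
    then have "(\<Sum>i<k. f (\<omega> i)) = f (\<omega> 0) + (\<Sum>i<j. f (\<omega> (Suc i)))"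
      by (simp add: sum.lessThan_Suc_shift del: sum.lessThan_Suc)
    also have "\<dots> \<le> f (\<omega> 0) + max_partial_sum f n (\<lambda>i. \<omega> (Suc i))"
      using Suc.IH[of j "\<lambda>i. \<omega> (Suc i)"] Suc.prems Suc by simp
    finally show ?thesis by simp
  qed
qed

lemma max_partial_sum_le:
  assumes "\<And>x. x \<in> space N \<Longrightarrow> f x \<le> b" "0 \<le> b" "\<omega> \<in> space \<Omega>"
  shows "max_partial_sum f n \<omega> \<le> real n * b"
  using assms(3)
proof (induction n arbitrary: \<omega>)
  case 0
  then show ?case by simp
next
  case (Suc n)
  have "\<omega> 0 \<in> space N"
    using Suc.prems by (simp add: space_PiM PiE_iff)
  moreover have "max_partial_sum f n (\<lambda>i. \<omega> (Suc i)) \<le> real n * b"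
    by (rule Suc.IH[OF measurable_space[OF measurable_shift_Suc Suc.prems]])
  ultimately show ?case
    using assms(1)[of "\<omega> 0"] assms(2) by (auto simp: algebra_simps)
qed

lemma borel_measurable_max_partial_sum:
  assumes [measurable]: "f \<in> borel_measurable N"
  shows "max_partial_sum f n \<in> borel_measurable \<Omega>"
proof (induction n)
  case 0
  have "max_partial_sum f 0 = (\<lambda>_. 0)" by auto
  then show ?case by simp
next
  case (Suc n)
  note [measurable] = measurable_compose[OF measurable_shift_Suc Suc]
  have "max_partial_sum f (Suc n) = (\<lambda>\<omega>. max 0 (f (\<omega> 0) + max_partial_sum f n (\<lambda>i. \<omega> (Suc i))))"
    by auto
  then show ?case
    by simp
qed

text \<open>
  The event that the partial sums are unbounded above. For \<open>f - c\<close> in place of \<open>f\<close> its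
  complement forces the upper limit of the averages of \<open>f\<close> to be at most \<open>c\<close>. Unlike the event
  that this upper limit exceeds \<open>c\<close>, it is evidently shift-invariant.
\<close>
definition unbounded_sums :: "('z \<Rightarrow> real) \<Rightarrow> (nat \<Rightarrow> 'z) set" where
  "unbounded_sums f = {\<omega>\<in>space \<Omega>. \<forall>m::nat. \<exists>n. (\<Sum>i<n. f (\<omega> i)) > real m}"

lemma shift_invariant_unbounded_sums:
  assumes [measurable]: "f \<in> borel_measurable N"
  shows "shift_invariant (unbounded_sums f)"
  unfolding shift_invariant_def
proof (intro conjI ballI)
  show "unbounded_sums f \<in> sets \<Omega>"
    unfolding unbounded_sums_def by measurable
  fix \<omega> assume \<omega>: "\<omega> \<in> space \<Omega>"
  have S: "(\<Sum>i<Suc n. f (\<omega> i)) = f (\<omega> 0) + (\<Sum>i<n. f (\<omega> (Suc i)))" for n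
    by (simp add: sum.lessThan_Suc_shift del: sum.lessThan_Suc)
  have "\<exists>n. (\<Sum>i<n. f (\<omega> (Suc i))) > real m" if *: "\<And>m::nat. \<exists>n. (\<Sum>i<n. f (\<omega> i)) > real m" for m
  proof -
    obtain k :: nat where k: "real k \<ge> real m + \<bar>f (\<omega> 0)\<bar>"
      using real_arch_simple by blast
    obtain n where n: "(\<Sum>i<n. f (\<omega> i)) > real k" using * by blast
    then obtain j where "n = Suc j" by (cases n) auto
    with n k S[of j] have "(\<Sum>i<j. f (\<omega> (Suc i))) > real m" by simp
    then show ?thesis ..
  qed
  moreover have "\<exists>n. (\<Sum>i<n. f (\<omega> i)) > real m" if *: "\<And>m::nat. \<exists>n. (\<Sum>i<n. f (\<omega> (Suc i))) > real m" for m
  proof -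
    obtain k :: nat where k: "real k \<ge> real m + \<bar>f (\<omega> 0)\<bar>"
      using real_arch_simple by blast
    obtain n where n: "(\<Sum>i<n. f (\<omega> (Suc i))) > real k" using * by blast
    with k S[of n] show ?thesis by (intro exI[of _ "Suc n"]) linarith
  qed
  ultimately show "(\<lambda>i. \<omega> (Suc i)) \<in> unbounded_sums f \<longleftrightarrow> \<omega> \<in> unbounded_sums f"
    unfolding unbounded_sums_def using \<omega> measurable_space[OF measurable_shift_Suc \<omega>] by blast
qed

end

context stationary_kernel
begin

lemma integral_stationary_law_shift:
  fixes G :: "(nat \<Rightarrow> 'z) \<Rightarrow> real"
  assumes "G \<in> borel_measurable \<Omega>"
  shows "(\<integral>\<omega>. G (\<lambda>i. \<omega> (Suc i)) \<partial>\<P>\<^sub>\<nu>) = (\<integral>\<omega>. G \<omega> \<partial>\<P>\<^sub>\<nu>)"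
proof -
  have m: "(\<lambda>\<omega> i. \<omega> (Suc i)) \<in> \<P>\<^sub>\<nu> \<rightarrow>\<^sub>M \<Omega>"
    by (subst measurable_cong_sets[OF sets_stationary_law refl]) (rule measurable_shift_Suc)
  show ?thesis
    using integral_distr[OF m assms] by (simp add: distr_stationary_law_shift)
qed

lemma integral_stationary_law_component:
  fixes f :: "'z \<Rightarrow> real"
  assumes "f \<in> borel_measurable N"
  shows "(\<integral>\<omega>. f (\<omega> n) \<partial>\<P>\<^sub>\<nu>) = (\<integral>x. f x \<partial>\<nu>)"
proof -
  have "(\<lambda>\<omega>. \<omega> n) \<in> \<P>\<^sub>\<nu> \<rightarrow>\<^sub>M N" by measurable
  from integral_distr[OF this assms] show ?thesis
    by (simp add: distr_stationary_law_component)
qed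

text \<open>
  Hopf's maximal ergodic lemma for the stationary chain, by Garsia's argument.
\<close>
lemma maximal_ergodic:
  fixes f :: "'z \<Rightarrow> real"
  assumes f [measurable]: "f \<in> borel_measurable N" and bound: "\<And>x. x \<in> space N \<Longrightarrow> \<bar>f x\<bar> \<le> b"
  shows "0 \<le> (\<integral>\<omega>. f (\<omega> 0) * indicator {\<omega>. max_partial_sum f (Suc n) \<omega> > 0} \<omega> \<partial>\<P>\<^sub>\<nu>)"
proof -
  let ?S = "max_partial_sum f"
  note meas [measurable] = borel_measurable_max_partial_sum[OF f]
  have sp: "\<omega> 0 \<in> space N" if "\<omega> \<in> space \<Omega>" for \<omega>
    using that by (simp add: space_PiM PiE_iff)
  have b: "0 \<le> b" if "\<omega> \<in> space \<Omega>" for \<omega>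
    using bound[OF sp[OF that]] by simp
  have int_S: "integrable \<P>\<^sub>\<nu> (?S k)" for k
  proof (rule \<P>\<nu>.integrable_const_bound[where B="real k * b"])
    show "AE \<omega> in \<P>\<^sub>\<nu>. norm (?S k \<omega>) \<le> real k * b"
    proof (intro AE_I2)
      fix \<omega> assume "\<omega> \<in> space \<P>\<^sub>\<nu>"
      then have \<omega>: "\<omega> \<in> space \<Omega>" by simp
      have "f x \<le> b" if "x \<in> space N" for x using bound[OF that] by simp
      then show "norm (?S k \<omega>) \<le> real k * b"
        using max_partial_sum_le[of f b \<omega> k] b[OF \<omega>] \<omega> max_partial_sum_nonneg[of f k \<omega>] by simp
    qed
  qed measurable
  have shift_meas: "(\<lambda>\<omega>. ?S k (\<lambda>i. \<omega> (Suc i))) \<in> borel_measurable \<P>\<^sub>\<nu>" for k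
    by (subst measurable_cong_sets[OF sets_stationary_law refl])
      (rule measurable_compose[OF measurable_shift_Suc meas])
  have int_S': "integrable \<P>\<^sub>\<nu> (\<lambda>\<omega>. ?S k (\<lambda>i. \<omega> (Suc i)))" for k
  proof (rule \<P>\<nu>.integrable_const_bound[where B="real k * b", OF _ shift_meas])
    show "AE \<omega> in \<P>\<^sub>\<nu>. norm (?S k (\<lambda>i. \<omega> (Suc i))) \<le> real k * b"
    proof (intro AE_I2)
      fix \<omega> assume "\<omega> \<in> space \<P>\<^sub>\<nu>"
      then have \<omega>: "(\<lambda>i. \<omega> (Suc i)) \<in> space \<Omega>" using measurable_space[OF measurable_shift_Suc, of \<omega>] by simp
      have "f x \<le> b" if "x \<in> space N" for x using bound[OF that] by simp
      then show "norm (?S k (\<lambda>i. \<omega> (Suc i))) \<le> real k * b"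
        using max_partial_sum_le[of f b _ k, OF _ _ \<omega>] b[OF \<omega>] max_partial_sum_nonneg[of f k "\<lambda>i. \<omega> (Suc i)"] by simp
    qed
  qed
  have int_f: "integrable \<P>\<^sub>\<nu> (\<lambda>\<omega>. f (\<omega> 0) * indicator {\<omega>. ?S (Suc n) \<omega> > 0} \<omega>)"
  proof (rule \<P>\<nu>.integrable_const_bound[where B=b])
    show "AE \<omega> in \<P>\<^sub>\<nu>. norm (f (\<omega> 0) * indicator {\<omega>. ?S (Suc n) \<omega> > 0} \<omega>) \<le> b"
    proof (intro AE_I2)
      fix \<omega> assume "\<omega> \<in> space \<P>\<^sub>\<nu>"
      then have \<omega>: "\<omega> \<in> space \<Omega>" by simp
      show "norm (f (\<omega> 0) * indicator {\<omega>. ?S (Suc n) \<omega> > 0} \<omega>) \<le> b"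
        using bound[OF sp[OF \<omega>]] b[OF \<omega>] by (auto split: split_indicator simp del: max_partial_sum.simps)
    qed
    have "(\<lambda>\<omega>. f (\<omega> 0) * (if ?S (Suc n) \<omega> > 0 then 1 else 0)) \<in> borel_measurable \<P>\<^sub>\<nu>"
      using meas[of "Suc n"] by (simp del: max_partial_sum.simps)
    then show "(\<lambda>\<omega>. f (\<omega> 0) * indicator {\<omega>. ?S (Suc n) \<omega> > 0} \<omega>) \<in> borel_measurable \<P>\<^sub>\<nu>"
      by (simp add: indicator_def del: max_partial_sum.simps)
  qed
  have "(\<integral>\<omega>. ?S n (\<lambda>i. \<omega> (Suc i)) \<partial>\<P>\<^sub>\<nu>) = (\<integral>\<omega>. ?S n \<omega> \<partial>\<P>\<^sub>\<nu>)"
    by (rule integral_stationary_law_shift[OF meas])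
  also have "\<dots> \<le> (\<integral>\<omega>. ?S (Suc n) \<omega> \<partial>\<P>\<^sub>\<nu>)"
    by (intro integral_mono int_S max_partial_sum_mono)
  finally have "0 \<le> (\<integral>\<omega>. ?S (Suc n) \<omega> \<partial>\<P>\<^sub>\<nu>) - (\<integral>\<omega>. ?S n (\<lambda>i. \<omega> (Suc i)) \<partial>\<P>\<^sub>\<nu>)"
    by simp
  also have "\<dots> = (\<integral>\<omega>. ?S (Suc n) \<omega> - ?S n (\<lambda>i. \<omega> (Suc i)) \<partial>\<P>\<^sub>\<nu>)"
    by (rule Bochner_Integration.integral_diff[symmetric, OF int_S int_S'])
  also have "\<dots> \<le> (\<integral>\<omega>. f (\<omega> 0) * indicator {\<omega>. ?S (Suc n) \<omega> > 0} \<omega> \<partial>\<P>\<^sub>\<nu>)"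
  proof (rule integral_mono[OF Bochner_Integration.integrable_diff[OF int_S int_S'] int_f])
    fix \<omega>
    \<comment> \<open>an equality where the maximum is positive; elsewhere the left side is at most \<open>0\<close>\<close>
    show "?S (Suc n) \<omega> - ?S n (\<lambda>i. \<omega> (Suc i)) \<le> f (\<omega> 0) * indicator {\<omega>. ?S (Suc n) \<omega> > 0} \<omega>"
      using max_partial_sum_nonneg[of f n "\<lambda>i. \<omega> (Suc i)"] by (auto simp: indicator_def max_def)
  qed
  finally show ?thesis .
qed

lemma integral_nonneg_of_positive_sums:
  fixes f :: "'z \<Rightarrow> real"
  assumes f [measurable]: "f \<in> borel_measurable N" and bound: "\<And>x. x \<in> space N \<Longrightarrow> \<bar>f x\<bar> \<le> b"
    and pos: "AE \<omega> in \<P>\<^sub>\<nu>. \<exists>k. (\<Sum>i<k. f (\<omega> i)) > 0"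
  shows "0 \<le> (\<integral>x. f x \<partial>\<nu>)"
proof -
  let ?S = "max_partial_sum f"
  let ?g = "\<lambda>n \<omega>. f (\<omega> 0) * indicator {\<omega>. ?S (Suc n) \<omega> > 0} \<omega>"
  note meas [measurable] = borel_measurable_max_partial_sum[OF f]
  have sp: "\<omega> 0 \<in> space N" if "\<omega> \<in> space \<Omega>" for \<omega>
    using that by (simp add: space_PiM PiE_iff)
  have "(\<lambda>n. \<integral>\<omega>. ?g n \<omega> \<partial>\<P>\<^sub>\<nu>) \<longlonglongrightarrow> (\<integral>\<omega>. f (\<omega> 0) \<partial>\<P>\<^sub>\<nu>)"
  proof (rule integral_dominated_convergence[where w="\<lambda>_. b"])
    show "AE \<omega> in \<P>\<^sub>\<nu>. (\<lambda>n. ?g n \<omega>) \<longlonglongrightarrow> f (\<omega> 0)"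
      using pos
    proof eventually_elim
      case (elim \<omega>)
      then obtain k where k: "(\<Sum>i<k. f (\<omega> i)) > 0" by blast
      have "?g n \<omega> = f (\<omega> 0)" if "k \<le> n" for n
      proof -
        have "(\<Sum>i<k. f (\<omega> i)) \<le> ?S (Suc n) \<omega>"
          using that by (intro partial_sum_le_max_partial_sum) simp
        with k show ?thesis by (simp del: max_partial_sum.simps)
      qed
      then show ?case
        by (intro tendsto_eventually) (auto simp: eventually_sequentially)
    qed
    show "AE \<omega> in \<P>\<^sub>\<nu>. norm (?g n \<omega>) \<le> b" for n
    proof (intro AE_I2)
      fix \<omega> assume "\<omega> \<in> space \<P>\<^sub>\<nu>"
      then show "norm (?g n \<omega>) \<le> b"
        using bound[OF sp[of \<omega>]] by (auto split: split_indicator simp del: max_partial_sum.simps)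
    qed
    show "?g n \<in> borel_measurable \<P>\<^sub>\<nu>" for n
    proof -
      have "(\<lambda>\<omega>. f (\<omega> 0) * (if ?S (Suc n) \<omega> > 0 then 1 else 0)) \<in> borel_measurable \<P>\<^sub>\<nu>"
        using meas[of "Suc n"] by (simp del: max_partial_sum.simps)
      then show ?thesis
        by (simp add: indicator_def del: max_partial_sum.simps)
    qed
  qed simp_all
  then have "0 \<le> (\<integral>\<omega>. f (\<omega> 0) \<partial>\<P>\<^sub>\<nu>)"
    by (rule LIMSEQ_le_const) (use maximal_ergodic[OF f bound] in blast)
  then show ?thesis
    by (simp add: integral_stationary_law_component)
qed

end

text \<open>
  Averages converge to \<open>L\<close> if, for every \<open>k\<close>, the sums exceed \<open>n * (L + 1 / (k + 1))\<close> and fall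
  short of \<open>n * (L - 1 / (k + 1))\<close> at most by amounts bounded in \<open>n\<close>.
\<close>
lemma averages_tendstoI:
  fixes s :: "nat \<Rightarrow> real"
  assumes upper: "\<And>k::nat. \<exists>m. \<forall>n. s n \<le> real n * (L + 1 / real (Suc k)) + m"
    and lower: "\<And>k::nat. \<exists>m. \<forall>n. s n \<ge> real n * (L - 1 / real (Suc k)) - m"
  shows "(\<lambda>n. s n / real n) \<longlonglongrightarrow> L"
proof (rule LIMSEQ_I)
  fix e :: real assume e: "0 < e"
  obtain k :: nat where k: "1 / real (Suc k) < e / 2"
    using reals_Archimedean[of "e / 2"] e by (auto simp: inverse_eq_divide)
  obtain m where m: "\<And>n. s n \<le> real n * (L + 1 / real (Suc k)) + m" using upper by blast
  obtain m' where m': "\<And>n. s n \<ge> real n * (L - 1 / real (Suc k)) - m'" using lower by blast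
  obtain n0 :: nat where n0: "real n0 > 2 * (\<bar>m\<bar> + \<bar>m'\<bar>) / e"
    using reals_Archimedean2 by blast
  have "norm (s n / real n - L) < e" if n: "n \<ge> Suc n0" for n
  proof -
    have n_pos: "real n > 0" using n by simp
    have small: "\<bar>m\<bar> + \<bar>m'\<bar> < real n * (e / 2)"
    proof -
      have "2 * (\<bar>m\<bar> + \<bar>m'\<bar>) < real n0 * e"
        using n0 e by (simp add: pos_divide_less_eq)
      also have "\<dots> \<le> real n * e"
        using n e by (intro mult_right_mono) auto
      finally show ?thesis by simp
    qed
    have kn: "real n * (1 / real (Suc k)) < real n * (e / 2)"
      by (rule mult_strict_left_mono[OF k n_pos])
    have "s n - real n * L < real n * e" "s n - real n * L > - (real n * e)"
      using m[of n] m'[of n] small kn unfolding distrib_left right_diff_distrib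
      by linarith+
    then have "\<bar>s n - real n * L\<bar> < real n * e" by linarith
    moreover have "s n / real n - L = (s n - real n * L) / real n"
      using n_pos by (simp add: field_simps)
    ultimately show ?thesis
      using n_pos by (simp add: field_simps)
  qed
  then show "\<exists>no. \<forall>n\<ge>no. norm (s n / real n - L) < e" by blast
qed

context harris_kernel
begin

text \<open>
  If \<open>f\<close> has negative mean, the sums cannot be unbounded above with probability one, as the
  maximal ergodic lemma would give a nonnegative mean; by triviality of shift-invariant events
  they are then bounded above almost surely, from every starting point.
\<close>
lemma bounded_sums_of_negative_mean:
  fixes f :: "'z \<Rightarrow> real"
  assumes f [measurable]: "f \<in> borel_measurable N" and bound: "\<And>x. x \<in> space N \<Longrightarrow> \<bar>f x\<bar> \<le> b"
    and neg: "(\<integral>x. f x \<partial>\<nu>) < 0" and x: "x \<in> space N"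
  shows "AE \<omega> in \<P> x. \<exists>m::nat. \<forall>n. (\<Sum>i<n. f (\<omega> i)) \<le> real m"
proof -
  let ?E = "unbounded_sums f"
  note E = shift_invariant_unbounded_sums[OF f]
  note Em [measurable] = shift_invariantD[OF E]
  have "\<not> (\<forall>x\<in>space N. emeasure (\<P> x) ?E = 1)"
  proof
    assume 1: "\<forall>x\<in>space N. emeasure (\<P> x) ?E = 1"
    have "emeasure \<P>\<^sub>\<nu> ?E = (\<integral>\<^sup>+x. 1 \<partial>\<nu>)"
      unfolding emeasure_stationary_law[OF Em] using 1 by (intro nn_integral_cong) simp
    then have "emeasure \<P>\<^sub>\<nu> ?E = 1"
      using \<nu>.emeasure_space_1 by simp
    then have "AE \<omega> in \<P>\<^sub>\<nu>. \<omega> \<in> ?E"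
      using Em by (intro \<P>\<nu>.AE_prob_1) (simp add: measure_def)
    then have "AE \<omega> in \<P>\<^sub>\<nu>. \<exists>k. (\<Sum>i<k. f (\<omega> i)) > 0"
    proof eventually_elim
      case (elim \<omega>)
      then have "\<forall>m::nat. \<exists>n. (\<Sum>i<n. f (\<omega> i)) > real m"
        by (simp add: unbounded_sums_def)
      from this[THEN spec, of 0] show ?case by simp
    qed
    from integral_nonneg_of_positive_sums[OF f bound this] neg show False by simp
  qed
  then have "emeasure (\<P> x) ?E = 0"
    using shift_invariant_trivial[OF E] x by blast
  moreover have "{\<omega>\<in>space (\<P> x). \<not> \<omega> \<notin> ?E} = ?E"
    using sets.sets_into_space[OF Em] x by auto
  ultimately have "AE \<omega> in \<P> x. \<omega> \<notin> ?E"
    using AE_iff_measurable[of ?E "\<P> x" "\<lambda>\<omega>. \<omega> \<notin> ?E"] x Em by simp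
  then show ?thesis
  proof (rule AE_mp, intro AE_I2 impI)
    fix \<omega> assume "\<omega> \<in> space (\<P> x)" "\<omega> \<notin> ?E"
    then show "\<exists>m::nat. \<forall>n. (\<Sum>i<n. f (\<omega> i)) \<le> real m"
      using x by (auto simp: unbounded_sums_def not_less)
  qed
qed

text \<open>
  The law of large numbers for bounded functions, from every starting point: the preceding
  lemma is applied to \<open>f - c\<close> and to \<open>- f - c\<close>, with \<open>c\<close> slightly above the respective mean.
\<close>
theorem path_averages:
  fixes f :: "'z \<Rightarrow> real"
  assumes f [measurable]: "f \<in> borel_measurable N" and bound: "\<And>x. x \<in> space N \<Longrightarrow> \<bar>f x\<bar> \<le> b"
    and x: "x \<in> space N"
  shows "AE \<omega> in \<P> x. (\<lambda>n. (\<Sum>i<n. f (\<omega> i)) / real n) \<longlonglongrightarrow> (\<integral>x. f x \<partial>\<nu>)"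
proof -
  let ?L = "\<integral>x. f x \<partial>\<nu>"
  have int: "integrable \<nu> f"
    using bound by (intro \<nu>.integrable_const_bound[where B=b] AE_I2) auto
  have up: "AE \<omega> in \<P> x. \<exists>m. \<forall>n. (\<Sum>i<n. g (\<omega> i)) \<le> real n * ((\<integral>x. g x \<partial>\<nu>) + 1 / real (Suc k)) + m"
    if g [measurable]: "g \<in> borel_measurable N" and gb: "\<And>x. x \<in> space N \<Longrightarrow> \<bar>g x\<bar> \<le> b" for g :: "'z \<Rightarrow> real" and k
  proof -
    define c where "c = (\<integral>x. g x \<partial>\<nu>) + 1 / real (Suc k)"
    have g_int: "integrable \<nu> g"
      using gb by (intro \<nu>.integrable_const_bound[where B=b] AE_I2) auto
    have "(\<integral>x. g x - c \<partial>\<nu>) = (\<integral>x. g x \<partial>\<nu>) - c"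
      using g_int \<nu>.prob_space by simp
    also have "\<dots> < 0" by (simp add: c_def)
    finally have neg: "(\<integral>x. g x - c \<partial>\<nu>) < 0" .
    have "AE \<omega> in \<P> x. \<exists>m::nat. \<forall>n. (\<Sum>i<n. g (\<omega> i) - c) \<le> real m"
    proof (rule bounded_sums_of_negative_mean[OF _ _ neg x])
      show "\<bar>g y - c\<bar> \<le> b + \<bar>c\<bar>" if "y \<in> space N" for y
        using gb[OF that] by linarith
    qed measurable
    then show ?thesis
    proof eventually_elim
      case (elim \<omega>)
      then obtain m :: nat where m: "\<And>n. (\<Sum>i<n. g (\<omega> i) - c) \<le> real m" by blast
      have "(\<Sum>i<n. g (\<omega> i)) \<le> real n * c + real m" for n
        using m[of n] by (simp add: sum_subtractf)
      then show ?case unfolding c_def by blast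
    qed
  qed
  have 1: "AE \<omega> in \<P> x. \<forall>k. \<exists>m. \<forall>n. (\<Sum>i<n. f (\<omega> i)) \<le> real n * (?L + 1 / real (Suc k)) + m"
    unfolding AE_all_countable using up[OF f bound] by blast
  have "AE \<omega> in \<P> x. \<forall>k. \<exists>m. \<forall>n. (\<Sum>i<n. - f (\<omega> i)) \<le> real n * ((\<integral>x. - f x \<partial>\<nu>) + 1 / real (Suc k)) + m"
    unfolding AE_all_countable using up[of "\<lambda>x. - f x"] bound by simp
  with 1 show ?thesis
  proof eventually_elim
    case (elim \<omega>)
    show ?case
    proof (rule averages_tendstoI)
      show "\<exists>m. \<forall>n. (\<Sum>i<n. f (\<omega> i)) \<le> real n * (?L + 1 / real (Suc k)) + m" for k
        using elim(1) by blast
      show "\<exists>m. \<forall>n. (\<Sum>i<n. f (\<omega> i)) \<ge> real n * (?L - 1 / real (Suc k)) - m" for k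
      proof -
        obtain m where m: "\<And>n. (\<Sum>i<n. - f (\<omega> i)) \<le> real n * ((\<integral>x. - f x \<partial>\<nu>) + 1 / real (Suc k)) + m"
          using elim(2) by blast
        have "(\<Sum>i<n. f (\<omega> i)) \<ge> real n * (?L - 1 / real (Suc k)) - m" for n
          using m[of n] by (simp add: sum_negf algebra_simps)
        then show ?thesis by blast
      qed
    qed
  qed
qed

end

section \<open>Conditional laws and chains on an arbitrary probability space\<close>

text \<open>
  A conditional law, which is given by conditional expectations of indicators with an exceptional
  set for each of them, yields an identity of measures on each event of the \<open>\<sigma>\<close>-algebra.
\<close>
lemma conditional_law_disintegration:
  assumes "prob_space M" and sub: "subalgebra M F"
    and Y [measurable]: "Y \<in> M \<rightarrow>\<^sub>M N" and \<kappa>: "\<kappa> \<in> M \<rightarrow>\<^sub>M prob_algebra N"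
    and law: "conditional_law M F N Y \<kappa>" and G: "G \<in> sets F"
  shows "distr (density M (indicator G)) N Y = density M (indicator G) \<bind> \<kappa>"
proof -
  interpret prob_space M by fact
  interpret finite_measure_subalgebra M F by unfold_locales (rule sub)
  have [measurable]: "G \<in> sets M"
    using G sub by (auto simp: subalgebra_def)
  have \<kappa>_sub [measurable]: "\<kappa> \<in> M \<rightarrow>\<^sub>M subprob_algebra N"
    using \<kappa> by (rule measurable_prob_algebraD)
  have \<kappa>_dens: "\<kappa> \<in> density M (indicator G) \<rightarrow>\<^sub>M subprob_algebra N"
    by measurable
  have ne: "space (density M (indicator G)) \<noteq> {}"
    by (simp add: not_empty)
  show ?thesis
  proof (rule measure_eqI)
    show "sets (distr (density M (indicator G)) N Y) = sets (density M (indicator G) \<bind> \<kappa>)"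
      using subprob_measurableD(2)[OF \<kappa>_sub] not_empty by (subst sets_bind[where N=N]) auto
    fix B assume "B \<in> sets (distr (density M (indicator G)) N Y)"
    then have B [measurable]: "B \<in> sets N" by simp
    have "emeasure (distr (density M (indicator G)) N Y) B =
        (\<integral>\<^sup>+\<omega>. ennreal (indicator G \<omega> * indicator B (Y \<omega>)) \<partial>M)"
      by (subst emeasure_distr)
        (auto simp: emeasure_density ennreal_indicator ennreal_mult indicator_def intro!: nn_integral_cong)
    also have "\<dots> = ennreal (\<integral>\<omega>. indicator G \<omega> * indicator B (Y \<omega>) \<partial>M)"
      by (intro nn_integral_eq_integral integrable_const_bound[where B=1] AE_I2)
        (auto simp: indicator_def)
    also have "(\<integral>\<omega>. indicator G \<omega> * indicator B (Y \<omega>) \<partial>M) =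
        (\<integral>\<omega>. indicator G \<omega> * real_cond_exp M F (\<lambda>\<omega>. indicator B (Y \<omega>)) \<omega> \<partial>M)"
      using G by (intro real_cond_exp_intg(2)[symmetric] integrable_const_bound[where B=1] AE_I2)
        (auto simp: indicator_def)
    also have "\<dots> = (\<integral>\<omega>. indicator G \<omega> * measure (\<kappa> \<omega>) B \<partial>M)"
    proof (rule integral_cong_AE)
      have "AE \<omega> in M. real_cond_exp M F (\<lambda>\<omega>. indicator B (Y \<omega>)) \<omega> = measure (\<kappa> \<omega>) B"
        using law B by (simp add: conditional_law_def)
      then show "AE \<omega> in M. indicator G \<omega> * real_cond_exp M F (\<lambda>\<omega>. indicator B (Y \<omega>)) \<omega> =
          indicator G \<omega> * measure (\<kappa> \<omega>) B"
        by eventually_elim simp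
    qed (use borel_measurable_cond_exp2 in measurable)
    also have "ennreal \<dots> = (\<integral>\<^sup>+\<omega>. ennreal (indicator G \<omega> * measure (\<kappa> \<omega>) B) \<partial>M)"
    proof (intro nn_integral_eq_integral[symmetric] integrable_const_bound[where B=1] AE_I2)
      fix \<omega> assume \<omega>: "\<omega> \<in> space M"
      have "prob_space (\<kappa> \<omega>)"
        using measurable_space[OF \<kappa> \<omega>] by (simp add: space_prob_algebra)
      then show "norm (indicator G \<omega> * measure (\<kappa> \<omega>) B) \<le> 1"
        using prob_space.prob_le_1 by (auto simp: indicator_def)
    qed auto
    also have "\<dots> = (\<integral>\<^sup>+\<omega>. indicator G \<omega> * emeasure (\<kappa> \<omega>) B \<partial>M)"
    proof (intro nn_integral_cong)
      fix \<omega> assume \<omega>: "\<omega> \<in> space M"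
      have "prob_space (\<kappa> \<omega>)"
        using measurable_space[OF \<kappa> \<omega>] by (simp add: space_prob_algebra)
      then interpret \<kappa>: prob_space "\<kappa> \<omega>" .
      show "ennreal (indicator G \<omega> * measure (\<kappa> \<omega>) B) = indicator G \<omega> * emeasure (\<kappa> \<omega>) B"
        by (simp add: \<kappa>.emeasure_eq_measure indicator_def)
    qed
    also have "\<dots> = (\<integral>\<^sup>+\<omega>. emeasure (\<kappa> \<omega>) B \<partial>density M (indicator G))"
      by (subst nn_integral_density) auto
    also have "\<dots> = emeasure (density M (indicator G) \<bind> \<kappa>) B"
      by (rule emeasure_bind[OF ne \<kappa>_dens B, symmetric])
    finally show "emeasure (distr (density M (indicator G)) N Y) B =
        emeasure (density M (indicator G) \<bind> \<kappa>) B" .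
  qed
qed

text \<open>
  The corresponding identity for integrals. The densities \<open>g (Y \<omega>)\<close> and \<open>\<integral> g d(\<kappa> \<omega>)\<close> define
  measures that agree on \<open>F\<close>, hence have the same integrals of \<open>F\<close>-measurable functions.
\<close>
lemma conditional_law_nn_integral:
  assumes M: "prob_space M" and sub: "subalgebra M F"
    and Y [measurable]: "Y \<in> M \<rightarrow>\<^sub>M N" and \<kappa>: "\<kappa> \<in> M \<rightarrow>\<^sub>M prob_algebra N"
    and law: "conditional_law M F N Y \<kappa>"
    and H: "H \<in> borel_measurable F" and g [measurable]: "g \<in> borel_measurable N"
  shows "(\<integral>\<^sup>+\<omega>. H \<omega> * g (Y \<omega>) \<partial>M) = (\<integral>\<^sup>+\<omega>. H \<omega> * (\<integral>\<^sup>+y. g y \<partial>\<kappa> \<omega>) \<partial>M)"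
proof -
  have \<kappa>_sub [measurable]: "\<kappa> \<in> M \<rightarrow>\<^sub>M subprob_algebra N"
    using \<kappa> by (rule measurable_prob_algebraD)
  have [measurable]: "H \<in> borel_measurable M"
    by (rule measurable_from_subalg[OF sub H])
  let ?g1 = "\<lambda>\<omega>. g (Y \<omega>)" and ?g2 = "\<lambda>\<omega>. \<integral>\<^sup>+y. g y \<partial>\<kappa> \<omega>"
  have g2 [measurable]: "?g2 \<in> borel_measurable M"
    by (rule measurable_compose[OF \<kappa>_sub nn_integral_measurable_subprob_algebra[OF g]])
  have sub': "subalgebra (density M f) F" for f
    using sub by (simp add: subalgebra_def)
  have "restr_to_subalg (density M ?g1) F = restr_to_subalg (density M ?g2) F"
  proof (rule measure_eqI)
    fix G assume "G \<in> sets (restr_to_subalg (density M ?g1) F)"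
    then have G: "G \<in> sets F" by (simp add: sets_restr_to_subalg[OF sub'])
    then have [measurable]: "G \<in> sets M"
      using sub by (auto simp: subalgebra_def)
    have "emeasure (density M ?g1) G = (\<integral>\<^sup>+\<omega>. g (Y \<omega>) \<partial>density M (indicator G))"
      by (simp add: emeasure_density nn_integral_density mult.commute)
    also have "\<dots> = (\<integral>\<^sup>+y. g y \<partial>distr (density M (indicator G)) N Y)"
      by (rule nn_integral_distr[symmetric]) auto
    also have "\<dots> = (\<integral>\<^sup>+y. g y \<partial>(density M (indicator G) \<bind> \<kappa>))"
      by (simp add: conditional_law_disintegration[OF M sub Y \<kappa> law G])
    also have "\<dots> = (\<integral>\<^sup>+\<omega>. \<integral>\<^sup>+y. g y \<partial>\<kappa> \<omega> \<partial>density M (indicator G))"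
      by (rule nn_integral_bind[OF g]) measurable
    also have "\<dots> = emeasure (density M ?g2) G"
      by (simp add: emeasure_density nn_integral_density mult.commute)
    finally show "emeasure (restr_to_subalg (density M ?g1) F) G =
        emeasure (restr_to_subalg (density M ?g2) F) G"
      using G by (simp add: emeasure_restr_to_subalg[OF sub'])
  qed (simp add: sets_restr_to_subalg[OF sub'])
  then have "(\<integral>\<^sup>+\<omega>. H \<omega> \<partial>density M ?g1) = (\<integral>\<^sup>+\<omega>. H \<omega> \<partial>density M ?g2)"
    using nn_integral_subalgebra2[OF sub' H] by metis
  then show ?thesis
    by (simp add: nn_integral_density mult.commute)
qed

text \<open>
  The law of a Markov chain is determined by its kernel and its initial distribution.
\<close>
lemma (in markov_kernel) markov_chain_law:
  assumes M: "prob_space M" and chain: "markov_chain M N K Z"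
  shows "distr M \<Omega> (\<lambda>\<omega> i. Z i \<omega>) = distr M N (Z 0) \<bind> \<P>"
proof -
  interpret M: prob_space M by (rule M)
  have Z [measurable]: "Z t \<in> M \<rightarrow>\<^sub>M N" for t
    using chain by (simp add: markov_chain_def)
  have Z\<Omega>: "(\<lambda>\<omega> i. Z i \<omega>) \<in> M \<rightarrow>\<^sub>M \<Omega>"
    by (rule measurable_PiM_single') (use measurable_space[OF Z] in \<open>auto simp: space_PiM PiE_iff\<close>)
  let ?F = "\<lambda>t. sigma (space M) {Z i -` B \<inter> space M |i B. i \<le> t \<and> B \<in> sets N}"
  have gen: "{Z i -` B \<inter> space M |i B. i \<le> t \<and> B \<in> sets N} \<subseteq> Pow (space M)" for t
    by auto
  have sub: "subalgebra M (?F t)" for t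
    unfolding subalgebra_def sets_measure_of[OF gen]
    by (auto intro!: sets.sigma_sets_subset simp: space_measure_of[OF gen])
  have ZF: "Z i \<in> ?F t \<rightarrow>\<^sub>M N" if "i \<le> t" for i t
  proof (rule measurableI)
    show "Z i \<omega> \<in> space N" if "\<omega> \<in> space (?F t)" for \<omega>
      using that measurable_space[OF Z] by (simp add: space_measure_of[OF gen])
    show "Z i -` B \<inter> space (?F t) \<in> sets (?F t)" if "B \<in> sets N" for B
      using that \<open>i \<le> t\<close> unfolding sets_measure_of[OF gen] space_measure_of[OF gen]
      by (intro sigma_sets.Basic) auto
  qed
  have step: "(\<integral>\<^sup>+\<omega>. (\<Prod>i\<le>n. g i (Z i \<omega>)) * h (Z (Suc n) \<omega>) \<partial>M) =
      (\<integral>\<^sup>+\<omega>. (\<Prod>i\<le>n. g i (Z i \<omega>)) * (\<integral>\<^sup>+z. h z \<partial>K (Z n \<omega>)) \<partial>M)"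
    if g: "\<And>i. g i \<in> borel_measurable N" and h: "h \<in> borel_measurable N" for n g h
  proof (rule conditional_law_nn_integral[OF M sub[of n] Z _ _ _ h])
    show "(\<lambda>\<omega>. K (Z n \<omega>)) \<in> M \<rightarrow>\<^sub>M prob_algebra N"
      by (rule measurable_compose[OF Z kernel])
    show "conditional_law M (?F n) N (Z (Suc n)) (\<lambda>\<omega>. K (Z n \<omega>))"
      using chain by (simp add: markov_chain_def)
    show "(\<lambda>\<omega>. \<Prod>i\<le>n. g i (Z i \<omega>)) \<in> borel_measurable (?F n)"
      by (intro borel_measurable_prod_ennreal measurable_compose[OF ZF g]) simp
  qed
  have ne: "space (distr M N (Z 0)) \<noteq> {}"
    using measurable_space[OF Z[of 0]] M.not_empty by auto
  have P: "\<P> \<in> distr M N (Z 0) \<rightarrow>\<^sub>M subprob_algebra \<Omega>"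
    by measurable
  show ?thesis
  proof (rule path_measure_eqI)
    show "sets (distr M N (Z 0) \<bind> \<P>) = sets \<Omega>"
      using ne by (intro sets_bind) auto
    show "emeasure (distr M \<Omega> (\<lambda>\<omega> i. Z i \<omega>)) (space \<Omega>) \<noteq> \<infinity>"
      using prob_space.emeasure_space_1[OF M.prob_space_distr[OF Z\<Omega>]] by simp
    fix n and B :: "nat \<Rightarrow> 'z set" assume B: "\<And>i. B i \<in> sets N"
    have fm: "fdd n (\<lambda>i. indicator (B i)) \<in> borel_measurable N"
      using B by (intro borel_measurable_fdd) simp
    have "emeasure (distr M \<Omega> (\<lambda>\<omega> i. Z i \<omega>)) (cylinder n B) =
        (\<integral>\<^sup>+\<omega>. indicator (cylinder n B) \<omega> \<partial>distr M \<Omega> (\<lambda>\<omega> i. Z i \<omega>))"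
      using sets_cylinder[OF B] by simp
    also have "\<dots> = (\<integral>\<^sup>+\<omega>. indicator (cylinder n B) (\<lambda>i. Z i \<omega>) \<partial>M)"
      using sets_cylinder[OF B] by (intro nn_integral_distr[OF Z\<Omega>]) simp
    also have "\<dots> = (\<integral>\<^sup>+\<omega>. (\<Prod>i\<le>n. indicator (B i) (Z i \<omega>)) \<partial>M)"
      using measurable_space[OF Z\<Omega>] by (intro nn_integral_cong indicator_cylinder) auto
    also have "\<dots> = (\<integral>\<^sup>+\<omega>. fdd n (\<lambda>i. indicator (B i)) (Z 0 \<omega>) \<partial>M)"
      using B by (intro nn_integral_fdd[OF Z step]) auto
    also have "\<dots> = (\<integral>\<^sup>+x. fdd n (\<lambda>i. indicator (B i)) x \<partial>distr M N (Z 0))"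
      using fm by (intro nn_integral_distr[symmetric] Z) simp
    also have "\<dots> = (\<integral>\<^sup>+x. emeasure (\<P> x) (cylinder n B) \<partial>distr M N (Z 0))"
      by (intro nn_integral_cong) (simp add: emeasure_path_law_cylinder B)
    also have "\<dots> = emeasure (distr M N (Z 0) \<bind> \<P>) (cylinder n B)"
      by (rule emeasure_bind[OF ne P sets_cylinder[OF B], symmetric])
    finally show "emeasure (distr M \<Omega> (\<lambda>\<omega> i. Z i \<omega>)) (cylinder n B) =
        emeasure (distr M N (Z 0) \<bind> \<P>) (cylinder n B)" .
  qed simp
qed

lemma (in harris_kernel) markov_chain_averages:
  fixes f :: "'z \<Rightarrow> real"
  assumes M: "prob_space M" and chain: "markov_chain M N K Z"
    and f [measurable]: "f \<in> borel_measurable N" and bound: "\<And>x. x \<in> space N \<Longrightarrow> \<bar>f x\<bar> \<le> b"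
  shows "AE \<omega> in M. (\<lambda>n. (\<Sum>i<n. f (Z i \<omega>)) / real n) \<longlonglongrightarrow> (\<integral>x. f x \<partial>\<nu>)"
proof -
  interpret M: prob_space M by (rule M)
  have Z [measurable]: "Z t \<in> M \<rightarrow>\<^sub>M N" for t
    using chain by (simp add: markov_chain_def)
  have Z\<Omega>: "(\<lambda>\<omega> i. Z i \<omega>) \<in> M \<rightarrow>\<^sub>M \<Omega>"
    by (rule measurable_PiM_single') (use measurable_space[OF Z] in \<open>auto simp: space_PiM PiE_iff\<close>)
  let ?Q = "\<lambda>\<omega>. (\<lambda>n. (\<Sum>i<n. f (\<omega> i)) / real n) \<longlonglongrightarrow> (\<integral>x. f x \<partial>\<nu>)"
  have Q: "Measurable.pred \<Omega> ?Q"
    by measurable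
  have P: "\<P> \<in> distr M N (Z 0) \<rightarrow>\<^sub>M subprob_algebra \<Omega>"
    by measurable
  have "AE \<omega> in distr M N (Z 0) \<bind> \<P>. ?Q \<omega>"
    by (subst AE_bind[OF P Q]) (intro AE_I2 path_averages[OF f bound], auto)
  then have "AE \<omega> in distr M \<Omega> (\<lambda>\<omega> i. Z i \<omega>). ?Q \<omega>"
    by (subst markov_chain_law[OF M chain])
  then show ?thesis
    using Q by (subst (asm) AE_distr_iff[OF Z\<Omega>]) (auto simp: pred_def)
qed

text \<open>
  Strong law for bounded orthogonal random variables. The second moment of the \<open>n\<close>-th partial
  sum is at most \<open>n\<close>, so along the squares the squared averages have summable expectations and
  tend to zero; since \<open>\<bar>D i\<bar> \<le> 1\<close>, the sums between consecutive squares \<open>m\<^sup>2\<close> and \<open>(m + 1)\<^sup>2\<close>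
  change by at most \<open>2 * m\<close>.
\<close>
lemma averages_of_orthogonal:
  fixes D :: "nat \<Rightarrow> 'w \<Rightarrow> real"
  assumes "prob_space M"
    and D [measurable]: "\<And>i. D i \<in> borel_measurable M"
    and bound: "\<And>i \<omega>. \<omega> \<in> space M \<Longrightarrow> \<bar>D i \<omega>\<bar> \<le> 1"
    and orth: "\<And>i j. i < j \<Longrightarrow> (\<integral>\<omega>. D i \<omega> * D j \<omega> \<partial>M) = 0"
  shows "AE \<omega> in M. (\<lambda>n. (\<Sum>i<n. D i \<omega>) / real n) \<longlonglongrightarrow> 0"
proof -
  interpret prob_space M by fact
  let ?S = "\<lambda>n \<omega>. \<Sum>i<n. D i \<omega>"
  have sum_bound: "\<bar>\<Sum>i\<in>I. D i \<omega>\<bar> \<le> real (card I)" if "\<omega> \<in> space M" for I \<omega>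
  proof -
    have "\<bar>\<Sum>i\<in>I. D i \<omega>\<bar> \<le> (\<Sum>i\<in>I. \<bar>D i \<omega>\<bar>)"
      by (rule sum_abs)
    also have "\<dots> \<le> of_nat (card I) * 1"
      by (intro sum_bounded_above bound that)
    finally show ?thesis by simp
  qed
  have S_bound: "\<bar>?S n \<omega>\<bar> \<le> real n" if "\<omega> \<in> space M" for n \<omega>
    using sum_bound[OF that, of "{..<n}"] by simp
  have int_mult: "integrable M (\<lambda>\<omega>. u \<omega> * v \<omega>)"
    if [measurable]: "u \<in> borel_measurable M" "v \<in> borel_measurable M"
      and uv: "\<And>\<omega>. \<omega> \<in> space M \<Longrightarrow> \<bar>u \<omega>\<bar> \<le> a" "\<And>\<omega>. \<omega> \<in> space M \<Longrightarrow> \<bar>v \<omega>\<bar> \<le> b"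
    for u v :: "'w \<Rightarrow> real" and a b
  proof (rule integrable_const_bound[where B="a * b"])
    show "AE \<omega> in M. norm (u \<omega> * v \<omega>) \<le> a * b"
    proof (intro AE_I2)
      fix \<omega> assume \<omega>: "\<omega> \<in> space M"
      have "0 \<le> a" using uv(1)[OF \<omega>] by linarith
      then show "norm (u \<omega> * v \<omega>) \<le> a * b"
        using mult_mono[OF uv(1)[OF \<omega>] uv(2)[OF \<omega>]] by (simp add: abs_mult)
    qed
  qed measurable
  have int_SS: "integrable M (\<lambda>\<omega>. ?S n \<omega> * ?S n \<omega>)" for n
    by (rule int_mult[OF _ _ S_bound S_bound]) measurable
  have int_SD: "integrable M (\<lambda>\<omega>. ?S n \<omega> * D n \<omega>)" for n
    by (rule int_mult[OF _ _ S_bound bound]) measurable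
  have int_DD: "integrable M (\<lambda>\<omega>. D i \<omega> * D j \<omega>)" for i j
    by (rule int_mult[OF _ _ bound bound]) measurable
  have SD: "(\<integral>\<omega>. ?S n \<omega> * D n \<omega> \<partial>M) = 0" for n
  proof -
    have "(\<integral>\<omega>. ?S n \<omega> * D n \<omega> \<partial>M) = (\<Sum>i<n. \<integral>\<omega>. D i \<omega> * D n \<omega> \<partial>M)"
      by (simp add: sum_distrib_right int_DD)
    then show ?thesis using orth by simp
  qed
  have SS: "(\<integral>\<omega>. ?S n \<omega> * ?S n \<omega> \<partial>M) \<le> real n" for n
  proof (induction n)
    case 0
    then show ?case by simp
  next
    case (Suc n)
    have "(\<integral>\<omega>. ?S (Suc n) \<omega> * ?S (Suc n) \<omega> \<partial>M) =
        (\<integral>\<omega>. ?S n \<omega> * ?S n \<omega> + 2 * (?S n \<omega> * D n \<omega>) + D n \<omega> * D n \<omega> \<partial>M)"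
      by (intro Bochner_Integration.integral_cong) (auto simp: algebra_simps)
    also have "\<dots> = (\<integral>\<omega>. ?S n \<omega> * ?S n \<omega> \<partial>M) + (\<integral>\<omega>. D n \<omega> * D n \<omega> \<partial>M)"
      using int_SS[of n] int_SD[of n] int_DD[of n n] SD[of n] by simp
    also have "(\<integral>\<omega>. D n \<omega> * D n \<omega> \<partial>M) \<le> (\<integral>\<omega>. 1 \<partial>M)"
    proof (intro integral_mono int_DD)
      fix \<omega> assume "\<omega> \<in> space M"
      from mult_mono[OF bound[OF this] bound[OF this], of n n]
      show "D n \<omega> * D n \<omega> \<le> 1" by (simp add: abs_mult_self_eq)
    qed simp
    finally show ?case using Suc prob_space by simp
  qed
  let ?Y = "\<lambda>k \<omega>. (?S ((Suc k)\<^sup>2) \<omega> / real ((Suc k)\<^sup>2))\<^sup>2"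
  have Y: "(\<integral>\<^sup>+\<omega>. ennreal (?Y k \<omega>) \<partial>M) \<le> ennreal (1 / real ((Suc k)\<^sup>2))" for k
  proof -
    let ?n = "(Suc k)\<^sup>2"
    have div_sq: "a / (a * a) = 1 / a" for a :: real
      by simp
    have Y_eq: "?Y k \<omega> = (?S ?n \<omega> * ?S ?n \<omega>) / (real ?n * real ?n)" for \<omega>
      by (simp add: power2_eq_square)
    have "integrable M (?Y k)"
      unfolding Y_eq using int_SS[of ?n] by simp
    then have "(\<integral>\<^sup>+\<omega>. ennreal (?Y k \<omega>) \<partial>M) = ennreal (\<integral>\<omega>. ?Y k \<omega> \<partial>M)"
      by (intro nn_integral_eq_integral) auto
    also have "(\<integral>\<omega>. ?Y k \<omega> \<partial>M) = (\<integral>\<omega>. ?S ?n \<omega> * ?S ?n \<omega> \<partial>M) / (real ?n * real ?n)"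
      unfolding Y_eq by simp
    also have "\<dots> \<le> real ?n / (real ?n * real ?n)"
      by (intro divide_right_mono SS) simp
    also have "\<dots> = 1 / real ?n"
      by (rule div_sq)
    finally show ?thesis
      by (simp add: ennreal_leI)
  qed
  have "(\<integral>\<^sup>+\<omega>. (\<Sum>k. ennreal (?Y k \<omega>)) \<partial>M) = (\<Sum>k. \<integral>\<^sup>+\<omega>. ennreal (?Y k \<omega>) \<partial>M)"
    by (rule nn_integral_suminf) simp
  also have "\<dots> \<le> (\<Sum>k. ennreal (1 / real ((Suc k)\<^sup>2)))"
    by (intro suminf_le Y) auto
  also have "\<dots> < \<infinity>"
  proof -
    have "summable (\<lambda>k. inverse ((real k)\<^sup>2))"
      by (rule inverse_power_summable) simp
    then have "summable (\<lambda>k. inverse ((real (Suc k))\<^sup>2))"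
      by (subst summable_Suc_iff)
    then have "summable (\<lambda>k. 1 / real ((Suc k)\<^sup>2))"
      by (simp only: inverse_eq_divide of_nat_power)
    then show ?thesis
      by (subst suminf_ennreal2) auto
  qed
  finally have fin: "(\<integral>\<^sup>+\<omega>. (\<Sum>k. ennreal (?Y k \<omega>)) \<partial>M) \<noteq> \<infinity>"
    by simp
  have "AE \<omega> in M. (\<Sum>k. ennreal (?Y k \<omega>)) \<noteq> \<infinity>"
    by (rule nn_integral_PInf_AE[OF _ fin]) simp
  then show ?thesis
  proof (rule AE_mp, intro AE_I2 impI)
    fix \<omega> assume \<omega>: "\<omega> \<in> space M" and "(\<Sum>k. ennreal (?Y k \<omega>)) \<noteq> \<infinity>"
    then have "summable (\<lambda>k. ?Y k \<omega>)"
      by (intro summable_suminf_not_top) auto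
    then have "(\<lambda>k. ?Y k \<omega>) \<longlonglongrightarrow> 0"
      by (rule summable_LIMSEQ_zero)
    then have "(\<lambda>k. sqrt (?Y k \<omega>)) \<longlonglongrightarrow> sqrt 0"
      by (rule tendsto_real_sqrt)
    then have sq: "(\<lambda>k. \<bar>?S ((Suc k)\<^sup>2) \<omega>\<bar> / real ((Suc k)\<^sup>2)) \<longlonglongrightarrow> 0"
      by (simp add: real_sqrt_abs)
    show "(\<lambda>n. ?S n \<omega> / real n) \<longlonglongrightarrow> 0"
    proof (rule LIMSEQ_I)
      fix e :: real assume e: "0 < e"
      obtain K where K: "\<And>k. k \<ge> K \<Longrightarrow> \<bar>?S ((Suc k)\<^sup>2) \<omega>\<bar> / real ((Suc k)\<^sup>2) < e / 2"
        using LIMSEQ_D[OF sq, of "e / 2"] e by auto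
      obtain L :: nat where L: "real L > 4 / e"
        using reals_Archimedean2 by blast
      have "norm (?S n \<omega> / real n - 0) < e" if n: "n \<ge> (Suc (max K L))\<^sup>2" for n
      proof -
        define m where "m = floor_sqrt n"
        have "Suc (max K L) \<le> m"
          unfolding m_def using n by (rule le_floor_sqrtI)
        then obtain k where k: "m = Suc k" "K \<le> k" "L \<le> k"
          by (cases m) auto
        have mn: "m\<^sup>2 \<le> n" "n < (Suc m)\<^sup>2"
          by (simp_all add: m_def Suc_floor_sqrt_power2_gt)
        have m_pos: "real (m\<^sup>2) > 0" using k by simp
        have n_pos: "real n > 0" using mn(1) k by (cases n) auto
        have "?S n \<omega> = ?S (m\<^sup>2) \<omega> + (\<Sum>i=m\<^sup>2..<n. D i \<omega>)"
          using mn(1) by (simp add: lessThan_atLeast0 sum.atLeastLessThan_concat)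
        moreover have "\<bar>\<Sum>i=m\<^sup>2..<n. D i \<omega>\<bar> \<le> real (n - m\<^sup>2)"
          using sum_bound[OF \<omega>, of "{m\<^sup>2..<n}"] by simp
        moreover have "n - m\<^sup>2 \<le> 2 * m"
          using mn by (simp add: power2_eq_square)
        then have "real (n - m\<^sup>2) \<le> 2 * real m"
          by (metis of_nat_le_iff of_nat_mult of_nat_numeral)
        ultimately have "\<bar>?S n \<omega>\<bar> \<le> \<bar>?S (m\<^sup>2) \<omega>\<bar> + 2 * real m"
          by linarith
        then have "\<bar>?S n \<omega>\<bar> / real n \<le> (\<bar>?S (m\<^sup>2) \<omega>\<bar> + 2 * real m) / real (m\<^sup>2)"
          using mn(1) m_pos n_pos by (intro frac_le) auto
        also have "\<dots> = \<bar>?S (m\<^sup>2) \<omega>\<bar> / real (m\<^sup>2) + 2 / real m"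
          using m_pos by (simp add: add_divide_distrib power2_eq_square)
        also have "\<dots> < e / 2 + e / 2"
        proof (rule add_strict_mono)
          show "\<bar>?S (m\<^sup>2) \<omega>\<bar> / real (m\<^sup>2) < e / 2"
            using K[OF k(2)] k(1) by simp
          have "4 / e < real m" using L k by linarith
          then show "2 / real m < e / 2"
            using e k by (simp add: field_simps)
        qed
        finally show ?thesis
          using n_pos by (simp add: abs_divide)
      qed
      then show "\<exists>no. \<forall>n\<ge>no. norm (?S n \<omega> / real n - 0) < e" by blast
    qed
  qed
qed

section \<open>Rewards\<close>

lemma measurable_unit_borel: "f \<in> M \<rightarrow>\<^sub>M unit_borel \<Longrightarrow> f \<in> borel_measurable M"
  by (simp add: measurable_restrict_space2_iff)

lemma measurable_snd_reward: "snd \<in> borel_measurable (\<S> \<Otimes>\<^sub>M unit_borel)"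
  by (rule measurable_unit_borel[OF measurable_snd])

context
  fixes M :: "'w measure" and \<S> :: "'s measure" and \<A> :: "'a measure"
    and S :: "nat \<Rightarrow> 'w \<Rightarrow> 's" and A :: "nat \<Rightarrow> 'w \<Rightarrow> 'a" and X :: "nat \<Rightarrow> 'w \<Rightarrow> real"
  assumes S: "\<And>t. S t \<in> M \<rightarrow>\<^sub>M \<S>" and A: "\<And>t. A t \<in> M \<rightarrow>\<^sub>M \<A>"
    and X: "\<And>t. 1 \<le> t \<Longrightarrow> X t \<in> M \<rightarrow>\<^sub>M unit_borel"
begin

text \<open>
  The generating events of the history \<open>\<sigma>\<close>-algebra at time \<open>t\<close>, action \<open>A t\<close> included.
\<close>
definition history_generator :: "nat \<Rightarrow> 'w set set" where
  "history_generator t =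
     {S i -` B \<inter> space M |i B. i \<le> t \<and> B \<in> sets \<S>} \<union>
     {A i -` B \<inter> space M |i B. i \<le> t \<and> B \<in> sets \<A>} \<union>
     {X i -` B \<inter> space M |i B. 1 \<le> i \<and> i \<le> t \<and> B \<in> sets unit_borel}"

lemma history_generator_subset: "history_generator t \<subseteq> Pow (space M)"
  by (auto simp: history_generator_def)

lemma history_eq: "history M \<S> \<A> S A X t = sigma (space M) (history_generator t)"
  by (simp add: history_def history_generator_def)

lemma space_history: "space (history M \<S> \<A> S A X t) = space M"
  by (simp add: history_eq space_measure_of[OF history_generator_subset])

lemma in_history: "B \<in> history_generator t \<Longrightarrow> B \<in> sets (history M \<S> \<A> S A X t)"
  unfolding history_eq sets_measure_of[OF history_generator_subset] by (rule sigma_sets.Basic)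

lemma subalgebra_history: "subalgebra M (history M \<S> \<A> S A X t)"
proof -
  have "history_generator t \<subseteq> sets M"
    unfolding history_generator_def using measurable_sets[OF S] measurable_sets[OF A] measurable_sets[OF X]
    by blast
  then show ?thesis
    unfolding subalgebra_def space_history
    unfolding history_eq sets_measure_of[OF history_generator_subset]
    by (simp add: sets.sigma_sets_subset)
qed

lemma measurable_history:
  shows "i \<le> t \<Longrightarrow> S i \<in> history M \<S> \<A> S A X t \<rightarrow>\<^sub>M \<S>"
    and "i \<le> t \<Longrightarrow> A i \<in> history M \<S> \<A> S A X t \<rightarrow>\<^sub>M \<A>"
    and "1 \<le> i \<Longrightarrow> i \<le> t \<Longrightarrow> X i \<in> history M \<S> \<A> S A X t \<rightarrow>\<^sub>M unit_borel"
proof -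
  show "S i \<in> history M \<S> \<A> S A X t \<rightarrow>\<^sub>M \<S>" if "i \<le> t"
  proof (rule measurableI, goal_cases)
    case (1 x) then show ?case using measurable_space[OF S] by (simp add: space_history)
  next
    case (2 B) then show ?case
      unfolding space_history using that by (intro in_history) (auto simp: history_generator_def)
  qed
  show "A i \<in> history M \<S> \<A> S A X t \<rightarrow>\<^sub>M \<A>" if "i \<le> t"
  proof (rule measurableI, goal_cases)
    case (1 x) then show ?case using measurable_space[OF A] by (simp add: space_history)
  next
    case (2 B) then show ?case
      unfolding space_history using that by (intro in_history) (auto simp: history_generator_def)
  qed
  show "X i \<in> history M \<S> \<A> S A X t \<rightarrow>\<^sub>M unit_borel" if "1 \<le> i" "i \<le> t"
  proof (rule measurableI, goal_cases)
    case (1 x) then show ?case using measurable_space[OF X[OF that(1)]] by (simp add: space_history)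
  next
    case (2 B)
    have "X i -` B \<inter> space M \<in> history_generator t"
      unfolding history_generator_def using that 2 by blast
    then show ?case
      unfolding space_history by (rule in_history)
  qed
qed

end

context
  fixes \<S> :: "'s measure" and \<A> :: "'a measure" and P :: "'s \<times> 'a \<Rightarrow> ('s \<times> real) measure"
  assumes P: "P \<in> \<S> \<Otimes>\<^sub>M \<A> \<rightarrow>\<^sub>M prob_algebra (\<S> \<Otimes>\<^sub>M unit_borel)"
begin

lemma environment:
  assumes "z \<in> space (\<S> \<Otimes>\<^sub>M \<A>)"
  shows "prob_space (P z)" "sets (P z) = sets (\<S> \<Otimes>\<^sub>M unit_borel)"
    and "\<And>y. y \<in> space (P z) \<Longrightarrow> 0 \<le> snd y \<and> snd y \<le> 1"
proof -
  show "prob_space (P z)" and s: "sets (P z) = sets (\<S> \<Otimes>\<^sub>M unit_borel)"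
    using measurable_space[OF P assms] by (auto simp: space_prob_algebra)
  show "0 \<le> snd y \<and> snd y \<le> 1" if "y \<in> space (P z)" for y
    using that sets_eq_imp_space_eq[OF s] by (auto simp: space_pair_measure space_restrict_space)
qed

lemma integrable_reward:
  assumes z: "z \<in> space (\<S> \<Otimes>\<^sub>M \<A>)"
  shows "integrable (P z) snd"
proof -
  interpret Pz: prob_space "P z" by (rule environment(1)[OF z])
  have "snd \<in> borel_measurable (P z)"
    by (subst measurable_cong_sets[OF environment(2)[OF z] refl]) (rule measurable_snd_reward)
  then show ?thesis
    using environment(3)[OF z] by (intro Pz.integrable_const_bound[where B=1] AE_I2) auto
qed

lemma mean_reward_bounds:
  assumes z: "z \<in> space (\<S> \<Otimes>\<^sub>M \<A>)"
  shows "0 \<le> mean_reward P z" "mean_reward P z \<le> 1"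
proof -
  interpret Pz: prob_space "P z" by (rule environment(1)[OF z])
  show "0 \<le> mean_reward P z"
    unfolding mean_reward_def using environment(3)[OF z] by (intro integral_nonneg_AE AE_I2) auto
  have "mean_reward P z \<le> (\<integral>y. 1 \<partial>P z)"
    unfolding mean_reward_def using environment(3)[OF z] integrable_reward[OF z]
    by (intro integral_mono) auto
  then show "mean_reward P z \<le> 1"
    by (simp add: Pz.prob_space)
qed

lemma nn_integral_reward:
  assumes z: "z \<in> space (\<S> \<Otimes>\<^sub>M \<A>)"
  shows "(\<integral>\<^sup>+y. ennreal (snd y) \<partial>P z) = ennreal (mean_reward P z)"
  unfolding mean_reward_def using environment(3)[OF z]
  by (intro nn_integral_eq_integral integrable_reward[OF z] AE_I2) auto

lemma borel_measurable_mean_reward: "mean_reward P \<in> borel_measurable (\<S> \<Otimes>\<^sub>M \<A>)"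
  unfolding mean_reward_def
  by (rule measurable_compose[OF measurable_prob_algebraD[OF P]
        integral_measurable_subprob_algebra[OF measurable_snd_reward]])

text \<open>
  The mean reward is the conditional expectation of the next reward given any \<open>\<sigma>\<close>-algebra
  between the one generated by the current state-action pair and the full history.
\<close>
lemma reward_conditional_expectation:
  assumes M: "prob_space M" and gen: "generated_by M \<S> \<A> \<pi> P S A X"
    and sub: "subalgebra (history M \<S> \<A> S A X t) F"
    and ZF: "(\<lambda>\<omega>. (S t \<omega>, A t \<omega>)) \<in> F \<rightarrow>\<^sub>M \<S> \<Otimes>\<^sub>M \<A>"
  shows "AE \<omega> in M. real_cond_exp M F (X (Suc t)) \<omega> = mean_reward P (S t \<omega>, A t \<omega>)"
proof -
  interpret prob_space M by (rule M)
  let ?Z = "\<lambda>\<omega>. (S t \<omega>, A t \<omega>)"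
  have S [measurable]: "S t \<in> M \<rightarrow>\<^sub>M \<S>" and A [measurable]: "A t \<in> M \<rightarrow>\<^sub>M \<A>"
    and X: "1 \<le> t \<Longrightarrow> X t \<in> M \<rightarrow>\<^sub>M unit_borel" for t
    using gen by (auto simp: generated_by_def)
  have X_Suc [measurable]: "X (Suc t) \<in> M \<rightarrow>\<^sub>M unit_borel"
    by (rule X) simp
  note X_meas [measurable] = measurable_unit_borel[OF X_Suc]
  have X_bounds: "0 \<le> X (Suc t) \<omega>" "X (Suc t) \<omega> \<le> 1" if "\<omega> \<in> space M" for \<omega>
    using measurable_space[OF X_Suc that] by (auto simp: space_restrict_space)
  have hist: "subalgebra M (history M \<S> \<A> S A X t)"
    by (rule subalgebra_history[OF S A X])
  have sub_M: "subalgebra M F"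
    using sub hist by (auto simp: subalgebra_def)
  interpret F: finite_measure_subalgebra M F
    by unfold_locales (rule sub_M)
  have Z: "?Z \<in> M \<rightarrow>\<^sub>M \<S> \<Otimes>\<^sub>M \<A>"
    by measurable
  have Z_space: "?Z \<omega> \<in> space (\<S> \<Otimes>\<^sub>M \<A>)" if "\<omega> \<in> space M" for \<omega>
    by (rule measurable_space[OF Z that])
  have r_F: "(\<lambda>\<omega>. mean_reward P (?Z \<omega>)) \<in> borel_measurable F"
    by (rule measurable_compose[OF ZF borel_measurable_mean_reward])
  have r_M [measurable]: "(\<lambda>\<omega>. mean_reward P (?Z \<omega>)) \<in> borel_measurable M"
    by (rule measurable_compose[OF Z borel_measurable_mean_reward])
  have law: "conditional_law M (history M \<S> \<A> S A X t) (\<S> \<Otimes>\<^sub>M unit_borel)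
      (\<lambda>\<omega>. (S (Suc t) \<omega>, X (Suc t) \<omega>)) (\<lambda>\<omega>. P (?Z \<omega>))"
    using gen by (simp add: generated_by_def)
  show ?thesis
  proof (rule F.real_cond_exp_charact[OF _ _ _ r_F])
    show "integrable M (X (Suc t))"
      using X_bounds by (intro integrable_const_bound[where B=1] AE_I2) auto
    show "integrable M (\<lambda>\<omega>. mean_reward P (?Z \<omega>))"
      using mean_reward_bounds[OF Z_space] by (intro integrable_const_bound[where B=1] AE_I2) auto
    fix G assume "G \<in> sets F"
    then have G: "G \<in> sets (history M \<S> \<A> S A X t)"
      using sub by (auto simp: subalgebra_def)
    then have [measurable]: "G \<in> sets M"
      using hist by (auto simp: subalgebra_def)
    have "(\<integral>\<omega>\<in>G. X (Suc t) \<omega> \<partial>M) = enn2real (\<integral>\<^sup>+\<omega>. ennreal (indicator G \<omega> * X (Suc t) \<omega>) \<partial>M)"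
      unfolding set_lebesgue_integral_def real_scaleR_def using X_bounds
      by (intro integral_eq_nn_integral AE_I2) (auto simp: indicator_def)
    also have "(\<integral>\<^sup>+\<omega>. ennreal (indicator G \<omega> * X (Suc t) \<omega>) \<partial>M) =
        (\<integral>\<^sup>+\<omega>. indicator G \<omega> * ennreal (snd (S (Suc t) \<omega>, X (Suc t) \<omega>)) \<partial>M)"
      by (intro nn_integral_cong) (auto simp: indicator_def)
    also have "\<dots> = (\<integral>\<^sup>+\<omega>. indicator G \<omega> * (\<integral>\<^sup>+y. ennreal (snd y) \<partial>P (?Z \<omega>)) \<partial>M)"
    proof (rule conditional_law_nn_integral[OF M hist _ _ law, where g="\<lambda>y. ennreal (snd y)"])
      show "(\<lambda>\<omega>. (S (Suc t) \<omega>, X (Suc t) \<omega>)) \<in> M \<rightarrow>\<^sub>M \<S> \<Otimes>\<^sub>M unit_borel"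
        by (intro measurable_Pair S X_Suc)
      show "(\<lambda>\<omega>. P (?Z \<omega>)) \<in> M \<rightarrow>\<^sub>M prob_algebra (\<S> \<Otimes>\<^sub>M unit_borel)"
        by (rule measurable_compose[OF Z P])
      show "indicator G \<in> borel_measurable (history M \<S> \<A> S A X t)"
        using G by simp
      show "(\<lambda>y. ennreal (snd y)) \<in> borel_measurable (\<S> \<Otimes>\<^sub>M unit_borel)"
        by (rule measurable_compose[OF measurable_snd_reward measurable_ennreal])
    qed
    also have "\<dots> = (\<integral>\<^sup>+\<omega>. ennreal (indicator G \<omega> * mean_reward P (?Z \<omega>)) \<partial>M)"
      using Z_space by (intro nn_integral_cong) (auto simp: indicator_def nn_integral_reward)
    also have "enn2real \<dots> = (\<integral>\<omega>\<in>G. mean_reward P (?Z \<omega>) \<partial>M)"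
      unfolding set_lebesgue_integral_def real_scaleR_def using mean_reward_bounds[OF Z_space]
      by (intro integral_eq_nn_integral[symmetric] AE_I2) (auto simp: indicator_def)
    finally show "(\<integral>\<omega>\<in>G. X (Suc t) \<omega> \<partial>M) = (\<integral>\<omega>\<in>G. mean_reward P (?Z \<omega>) \<partial>M)" .
  qed
qed

text \<open>
  The differences of the rewards and their conditional means are martingale differences with
  values in \<open>[-1, 1]\<close>; in particular they are orthogonal, so their averages vanish.
\<close>
lemma reward_noise_averages:
  assumes M: "prob_space M" and gen: "generated_by M \<S> \<A> \<pi> P S A X"
  shows "AE \<omega> in M. (\<lambda>n. (\<Sum>i<n. X (Suc i) \<omega> - mean_reward P (S i \<omega>, A i \<omega>)) / real n) \<longlonglongrightarrow> 0"
proof -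
  interpret prob_space M by (rule M)
  have S: "S t \<in> M \<rightarrow>\<^sub>M \<S>" and A: "A t \<in> M \<rightarrow>\<^sub>M \<A>"
    and X: "1 \<le> t \<Longrightarrow> X t \<in> M \<rightarrow>\<^sub>M unit_borel" for t
    using gen by (auto simp: generated_by_def)
  let ?H = "history M \<S> \<A> S A X"
  let ?r = "\<lambda>t \<omega>. mean_reward P (S t \<omega>, A t \<omega>)"
  let ?D = "\<lambda>t \<omega>. X (Suc t) \<omega> - ?r t \<omega>"
  note hist = subalgebra_history[OF S A X]
  have ZH: "(\<lambda>\<omega>. (S i \<omega>, A i \<omega>)) \<in> ?H t \<rightarrow>\<^sub>M \<S> \<Otimes>\<^sub>M \<A>" if "i \<le> t" for i t
    using measurable_history[OF S A X] that by (intro measurable_Pair) auto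
  have rH: "?r i \<in> borel_measurable (?H t)" if "i \<le> t" for i t
    by (rule measurable_compose[OF ZH[OF that] borel_measurable_mean_reward])
  have XM [measurable]: "X (Suc t) \<in> borel_measurable M" for t
    by (rule measurable_unit_borel[OF X]) simp
  have rM [measurable]: "?r t \<in> borel_measurable M" for t
    by (rule measurable_from_subalg[OF hist rH[OF order_refl]])
  have DH: "?D i \<in> borel_measurable (?H t)" if "i < t" for i t
    using that by (intro borel_measurable_diff rH measurable_unit_borel measurable_history[OF S A X]) auto
  have X_bounds: "0 \<le> X (Suc t) \<omega>" "X (Suc t) \<omega> \<le> 1" if "\<omega> \<in> space M" for \<omega> t
    using measurable_space[OF X[of "Suc t"] that] by (auto simp: space_restrict_space)
  have r_bounds: "0 \<le> ?r t \<omega>" "?r t \<omega> \<le> 1" if "\<omega> \<in> space M" for \<omega> t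
    using mean_reward_bounds[of "(S t \<omega>, A t \<omega>)"] measurable_space[OF S that] measurable_space[OF A that]
    by (auto simp: space_pair_measure)
  have D_bound: "\<bar>?D t \<omega>\<bar> \<le> 1" if "\<omega> \<in> space M" for \<omega> t
    using X_bounds[OF that, of t] r_bounds[OF that, of t] by linarith
  show ?thesis
  proof (rule averages_of_orthogonal[OF M])
    show "?D i \<in> borel_measurable M" for i
      by measurable
    show "\<bar>?D i \<omega>\<bar> \<le> 1" if "\<omega> \<in> space M" for i \<omega>
      by (rule D_bound[OF that])
    fix i j :: nat assume ij: "i < j"
    interpret H: finite_measure_subalgebra M "?H j"
      by unfold_locales (rule hist)
    have int_DX: "integrable M (\<lambda>\<omega>. ?D i \<omega> * X (Suc j) \<omega>)"
    proof (rule integrable_const_bound[where B=1])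
      show "AE \<omega> in M. norm (?D i \<omega> * X (Suc j) \<omega>) \<le> 1"
        using D_bound X_bounds by (intro AE_I2) (auto simp: abs_mult intro!: mult_le_one)
    qed measurable
    have int_Dr: "integrable M (\<lambda>\<omega>. ?D i \<omega> * ?r j \<omega>)"
    proof (rule integrable_const_bound[where B=1])
      show "AE \<omega> in M. norm (?D i \<omega> * ?r j \<omega>) \<le> 1"
        using D_bound r_bounds by (intro AE_I2) (auto simp: abs_mult intro!: mult_le_one)
    qed measurable
    have "(\<integral>\<omega>. ?D i \<omega> * X (Suc j) \<omega> \<partial>M) = (\<integral>\<omega>. ?D i \<omega> * real_cond_exp M (?H j) (X (Suc j)) \<omega> \<partial>M)"
      by (rule H.real_cond_exp_intg(2)[symmetric, OF int_DX DH[OF ij] XM])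
    also have "\<dots> = (\<integral>\<omega>. ?D i \<omega> * ?r j \<omega> \<partial>M)"
    proof (rule integral_cong_AE)
      have "AE \<omega> in M. real_cond_exp M (?H j) (X (Suc j)) \<omega> = ?r j \<omega>"
        by (rule reward_conditional_expectation[OF M gen _ ZH[OF order_refl]]) (simp add: subalgebra_def)
      then show "AE \<omega> in M. ?D i \<omega> * real_cond_exp M (?H j) (X (Suc j)) \<omega> = ?D i \<omega> * ?r j \<omega>"
        by eventually_elim simp
    qed (use borel_measurable_cond_exp2 in measurable)
    finally show "(\<integral>\<omega>. ?D i \<omega> * ?D j \<omega> \<partial>M) = 0"
      using int_DX int_Dr by (simp add: right_diff_distrib)
  qed
qed

end

theorem proposition9:
  fixes M :: "'w measure" and \<S> :: "'s measure" and \<A> :: "'a measure"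
    and \<pi> :: "'s \<Rightarrow> 'a measure" and P :: "'s \<times> 'a \<Rightarrow> ('s \<times> real) measure"
    and S :: "nat \<Rightarrow> 'w \<Rightarrow> 's" and A :: "nat \<Rightarrow> 'w \<Rightarrow> 'a" and X :: "nat \<Rightarrow> 'w \<Rightarrow> real"
    and \<nu> :: "('s \<times> 'a) measure"
  assumes "prob_space M"
    and "\<pi> \<in> \<S> \<rightarrow>\<^sub>M prob_algebra \<A>"
    and "P \<in> \<S> \<Otimes>\<^sub>M \<A> \<rightarrow>\<^sub>M prob_algebra (\<S> \<Otimes>\<^sub>M unit_borel)"
    and "generated_by M \<S> \<A> \<pi> P S A X"
    and "markov_chain M (\<S> \<Otimes>\<^sub>M \<A>) (state_action_kernel \<S> \<A> \<pi> P) (\<lambda>t \<omega>. (S t \<omega>, A t \<omega>))"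
    and "positive_harris_recurrent (\<S> \<Otimes>\<^sub>M \<A>) (state_action_kernel \<S> \<A> \<pi> P)"
    and "aperiodic (\<S> \<Otimes>\<^sub>M \<A>) (state_action_kernel \<S> \<A> \<pi> P)"
    and "invariant_probability (\<S> \<Otimes>\<^sub>M \<A>) (state_action_kernel \<S> \<A> \<pi> P) \<nu>"
  shows "(\<forall>z\<in>space (\<S> \<Otimes>\<^sub>M \<A>). mean_reward P z \<in> {0..1}) \<and>
         (\<forall>t. AE \<omega> in M.
            real_cond_exp M (vimage_algebra (space M) (\<lambda>\<omega>'. (S t \<omega>', A t \<omega>')) (\<S> \<Otimes>\<^sub>M \<A>))
              (X (Suc t)) \<omega> = mean_reward P (S t \<omega>, A t \<omega>)) \<and>
         (AE \<omega> in M. (\<lambda>n. (\<Sum>t=1..n. X t \<omega>) / real n)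
            \<longlonglongrightarrow> (\<integral>z. mean_reward P z \<partial>\<nu>))"
proof (intro conjI ballI allI)
  let ?N = "\<S> \<Otimes>\<^sub>M \<A>" and ?K = "state_action_kernel \<S> \<A> \<pi> P"
  note M = assms(1) and P = assms(3) and gen = assms(4) and chain = assms(5)
  interpret prob_space M by (rule M)
  have S: "S t \<in> M \<rightarrow>\<^sub>M \<S>" and A: "A t \<in> M \<rightarrow>\<^sub>M \<A>"
    and X: "1 \<le> t \<Longrightarrow> X t \<in> M \<rightarrow>\<^sub>M unit_borel" for t
    using gen by (auto simp: generated_by_def)
  show "mean_reward P z \<in> {0..1}" if "z \<in> space ?N" for z
    using mean_reward_bounds[OF P that] by simp
  show "AE \<omega> in M. real_cond_exp M (vimage_algebra (space M) (\<lambda>\<omega>'. (S t \<omega>', A t \<omega>')) ?N)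
      (X (Suc t)) \<omega> = mean_reward P (S t \<omega>, A t \<omega>)" for t
  proof (rule reward_conditional_expectation[OF P M gen])
    let ?Z = "\<lambda>\<omega>. (S t \<omega>, A t \<omega>)"
    have ZH: "?Z \<in> history M \<S> \<A> S A X t \<rightarrow>\<^sub>M ?N"
      using measurable_history[OF S A X] by (intro measurable_Pair) auto
    have Z_space: "?Z \<in> space M \<rightarrow> space ?N"
      using measurable_space[OF ZH] by (auto simp: space_history[OF S A X])
    show "subalgebra (history M \<S> \<A> S A X t) (vimage_algebra (space M) ?Z ?N)"
      using measurable_sets[OF ZH] Z_space
      by (auto simp: subalgebra_def space_history[OF S A X] sets_vimage_algebra2)
    show "?Z \<in> vimage_algebra (space M) ?Z ?N \<rightarrow>\<^sub>M ?N"
      by (rule measurable_vimage_algebra1[OF Z_space])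
  qed
  interpret harris_kernel ?N ?K \<nu>
    using chain assms(6,8)
    by unfold_locales (auto simp: markov_chain_def positive_harris_recurrent_def)
  have "AE \<omega> in M. (\<lambda>n. (\<Sum>i<n. mean_reward P (S i \<omega>, A i \<omega>)) / real n)
      \<longlonglongrightarrow> (\<integral>z. mean_reward P z \<partial>\<nu>)"
    by (rule markov_chain_averages[OF M chain borel_measurable_mean_reward[OF P], where b=1])
      (use mean_reward_bounds[OF P] in auto)
  with reward_noise_averages[OF P M gen]
  show "AE \<omega> in M. (\<lambda>n. (\<Sum>t=1..n. X t \<omega>) / real n) \<longlonglongrightarrow> (\<integral>z. mean_reward P z \<partial>\<nu>)"
  proof eventually_elim
    case (elim \<omega>)
    from tendsto_add[OF elim]
    show ?case
      by (simp add: sum_subtractf diff_divide_distrib sum.atLeast1_atMost_eq)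
  qed
qed

end
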